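(* For a partial solution $(A,w)$ and threshold $t\ge0$, there is an algorithm running in time $O(|E|)$ that returns a pair $(c_t,p_t)$ with $c_t\in C\setminus A$ and $p_t=\mathrm{prescore}_{(A,w)}(c_t,t)=\max_{c'\in C\setminus A}\mathrm{prescore}_{(A,w)}(c',t)$. Furthermore, there is an algorithm running in time $O(|E|\cdot\log k)$ that, given a partial solution $(A,w)$, returns a pair $(c_{\max},t_{\max})$ with $c_{\max}\in C\setminus A$ and $t_{\max}=\mathrm{score}_{(A,w)}(c_{\max})=\max_{c'\in C\setminus A}\mathrm{score}_{(A,w)}(c')$.
   Context: An election instance consists of a finite bipartite graph $G=(N\cup C,E)$ with no isolated vertices ($N$ = voters, $C$ = candidates), a vector $s\in\mathbb{R}^N$ of non-negative vote strengths, and an integer $k$ with $0<k<|C|$. Write $nc$ for $\{n,c\}$, $C_n=\{c: nc\in E\}$, $N_c=\{n: nc\in E\}$. A weight vector $w\in\mathbb{R}^E$ is feasible if $w\ge0$ and $\sum_{c\in C_n}w_{nc}\le s_n$ for all $n$. $\mathrm{supp}_w(c)=\sum_{n\in N_c}w_{nc}$. A partial solution is $(A,w)$ with $A\subseteq C$, $|A|\le k$, $w$ feasible; the supports $(\mathrm{supp}_w(c))_{c\in A}$ are assumed available. For $n\in N$, $t\ge0$: $\mathrm{slack}(n,t)=s_n-\sum_{c\in A\cap C_n}w_{nc}\min\{1,t/\mathrm{supp}_w(c)\}$; for $c'\in C\setminus A$, $\mathrm{prescore}_{(A,w)}(c',t)=\sum_{n\in N_{c'}}\mathrm{slack}(n,t)$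 and $\mathrm{score}_{(A,w)}(c')=\max\{t\ge0:\mathrm{prescore}_{(A,w)}(c',t)\ge t\}$. Numerical operations take constant time. *)

theory Defs
  imports Complex_Main
begin

section \<open>Elections and partial solutions\<close>

text \<open>
  The two sides of the bipartite graph live in different types and hence are disjoint; the edge
  \<open>nc\<close> is the pair \<open>(n, c)\<close>. Only the values of a weight vector on edges are relevant.
\<close>

record ('n, 'c) election =
  voters :: "'n set"
  cands :: "'c set"
  edges :: "('n \<times> 'c) set"
  strength :: "'n \<Rightarrow> real"
  seats :: nat

definition election_instance :: "('n, 'c) election \<Rightarrow> bool" where
  "election_instance I \<longleftrightarrow>
     finite (voters I) \<and> finite (cands I) \<and> edges I \<subseteq> voters I \<times> cands I \<and>
     (\<forall>n\<in>voters I. \<exists>c. (n, c) \<in> edges I) \<and> (\<forall>c\<in>cands I. \<exists>n. (n, c) \<in> edges I) \<and>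
     (\<forall>n\<in>voters I. 0 \<le> strength I n) \<and>
     0 < seats I \<and> seats I < card (cands I)"

definition cands_of :: "('n, 'c) election \<Rightarrow> 'n \<Rightarrow> 'c set" where
  "cands_of I n = {c. (n, c) \<in> edges I}"

definition voters_of :: "('n, 'c) election \<Rightarrow> 'c \<Rightarrow> 'n set" where
  "voters_of I c = {n. (n, c) \<in> edges I}"

definition feasible :: "('n, 'c) election \<Rightarrow> ('n \<times> 'c \<Rightarrow> real) \<Rightarrow> bool" where
  "feasible I w \<longleftrightarrow>
     (\<forall>e\<in>edges I. 0 \<le> w e) \<and> (\<forall>n\<in>voters I. (\<Sum>c\<in>cands_of I n. w (n, c)) \<le> strength I n)"

definition supp :: "('n, 'c) election \<Rightarrow> ('n \<times> 'c \<Rightarrow> real) \<Rightarrow> 'c \<Rightarrow> real" where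
  "supp I w c = (\<Sum>n\<in>voters_of I c. w (n, c))"

definition partial_solution ::
  "('n, 'c) election \<Rightarrow> 'c set \<Rightarrow> ('n \<times> 'c \<Rightarrow> real) \<Rightarrow> bool" where
  "partial_solution I A w \<longleftrightarrow> A \<subseteq> cands I \<and> card A \<le> seats I \<and> feasible I w"

text \<open>
  If \<open>supp I w c = 0\<close> then all weights \<open>w (n, c)\<close> of a feasible \<open>w\<close> vanish, so the value of the
  quotient by zero is immaterial.
\<close>

definition slack ::
  "('n, 'c) election \<Rightarrow> 'c set \<Rightarrow> ('n \<times> 'c \<Rightarrow> real) \<Rightarrow> 'n \<Rightarrow> real \<Rightarrow> real" where
  "slack I A w n t =
     strength I n - (\<Sum>c\<in>A \<inter> cands_of I n. w (n, c) * min 1 (t / supp I w c))"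

definition prescore ::
  "('n, 'c) election \<Rightarrow> 'c set \<Rightarrow> ('n \<times> 'c \<Rightarrow> real) \<Rightarrow> 'c \<Rightarrow> real \<Rightarrow> real" where
  "prescore I A w c t = (\<Sum>n\<in>voters_of I c. slack I A w n t)"

definition score ::
  "('n, 'c) election \<Rightarrow> 'c set \<Rightarrow> ('n \<times> 'c \<Rightarrow> real) \<Rightarrow> 'c \<Rightarrow> real" where
  "score I A w c = (GREATEST t. 0 \<le> t \<and> t \<le> prescore I A w c t)"


section \<open>A real random-access machine\<close>

text \<open>
  Algorithms are programs of a while language over natural-number and real registers and arrays,
  in which every operation and every memory access costs one unit. Naturals serve as indices and
  counters; they can only be added, subtracted (truncating at zero), halved and compared, so that
  unit cost gives no access to fast arithmetic on huge integers. Reals are manipulated only through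
  the field operations and comparisons; there is no rounding and no real constant other than
  natural numbers. Division by zero yields zero, which a program could also arrange by a test.
\<close>

datatype iexp =
    INum nat
  | IVar string
  | IArr string iexp
  | IAdd iexp iexp
  | ISub iexp iexp
  | IHalf iexp

datatype rexp =
    RNum nat
  | RVar string
  | RArr string iexp
  | RAdd rexp rexp
  | RSub rexp rexp
  | RMul rexp rexp
  | RDiv rexp rexp

datatype bexp =
    ILess iexp iexp
  | RLess rexp rexp
  | BNot bexp
  | BAnd bexp bexp

datatype com =
    Skip
  | ISet string iexp
  | RSet string rexp
  | IStore string iexp iexp
  | RStore string iexp rexp
  | Seq com com
  | Cond bexp com com
  | While bexp com

record state =
  ivar :: "string \<Rightarrow> nat"
  rvar :: "string \<Rightarrow> real"
  iarr :: "string \<Rightarrow> nat \<Rightarrow> nat"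
  rarr :: "string \<Rightarrow> nat \<Rightarrow> real"

primrec ival :: "iexp \<Rightarrow> state \<Rightarrow> nat" where
  "ival (INum m) \<sigma> = m"
| "ival (IVar x) \<sigma> = ivar \<sigma> x"
| "ival (IArr a e) \<sigma> = iarr \<sigma> a (ival e \<sigma>)"
| "ival (IAdd e f) \<sigma> = ival e \<sigma> + ival f \<sigma>"
| "ival (ISub e f) \<sigma> = ival e \<sigma> - ival f \<sigma>"
| "ival (IHalf e) \<sigma> = ival e \<sigma> div 2"

primrec rval :: "rexp \<Rightarrow> state \<Rightarrow> real" where
  "rval (RNum m) \<sigma> = real m"
| "rval (RVar x) \<sigma> = rvar \<sigma> x"
| "rval (RArr a e) \<sigma> = rarr \<sigma> a (ival e \<sigma>)"
| "rval (RAdd e f) \<sigma> = rval e \<sigma> + rval f \<sigma>"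
| "rval (RSub e f) \<sigma> = rval e \<sigma> - rval f \<sigma>"
| "rval (RMul e f) \<sigma> = rval e \<sigma> * rval f \<sigma>"
| "rval (RDiv e f) \<sigma> = rval e \<sigma> / rval f \<sigma>"

primrec bval :: "bexp \<Rightarrow> state \<Rightarrow> bool" where
  "bval (ILess e f) \<sigma> \<longleftrightarrow> ival e \<sigma> < ival f \<sigma>"
| "bval (RLess e f) \<sigma> \<longleftrightarrow> rval e \<sigma> < rval f \<sigma>"
| "bval (BNot b) \<sigma> \<longleftrightarrow> \<not> bval b \<sigma>"
| "bval (BAnd b d) \<sigma> \<longleftrightarrow> bval b \<sigma> \<and> bval d \<sigma>"

primrec icost :: "iexp \<Rightarrow> nat" where
  "icost (INum m) = 1"
| "icost (IVar x) = 1"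
| "icost (IArr a e) = icost e + 1"
| "icost (IAdd e f) = icost e + icost f + 1"
| "icost (ISub e f) = icost e + icost f + 1"
| "icost (IHalf e) = icost e + 1"

primrec rcost :: "rexp \<Rightarrow> nat" where
  "rcost (RNum m) = 1"
| "rcost (RVar x) = 1"
| "rcost (RArr a e) = icost e + 1"
| "rcost (RAdd e f) = rcost e + rcost f + 1"
| "rcost (RSub e f) = rcost e + rcost f + 1"
| "rcost (RMul e f) = rcost e + rcost f + 1"
| "rcost (RDiv e f) = rcost e + rcost f + 1"

primrec bcost :: "bexp \<Rightarrow> nat" where
  "bcost (ILess e f) = icost e + icost f + 1"
| "bcost (RLess e f) = rcost e + rcost f + 1"
| "bcost (BNot b) = bcost b + 1"
| "bcost (BAnd b d) = bcost b + bcost d + 1"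

text \<open>\<open>exec P \<sigma> T \<sigma>'\<close>: started in \<open>\<sigma>\<close>, the program \<open>P\<close> halts in \<open>\<sigma>'\<close> after exactly \<open>T\<close> units of time.\<close>

inductive exec :: "com \<Rightarrow> state \<Rightarrow> nat \<Rightarrow> state \<Rightarrow> bool" where
  Skip: "exec Skip \<sigma> 1 \<sigma>"
| ISet: "exec (ISet x e) \<sigma> (icost e + 1) (\<sigma>\<lparr>ivar := (ivar \<sigma>)(x := ival e \<sigma>)\<rparr>)"
| RSet: "exec (RSet x e) \<sigma> (rcost e + 1) (\<sigma>\<lparr>rvar := (rvar \<sigma>)(x := rval e \<sigma>)\<rparr>)"
| IStore: "exec (IStore a i e) \<sigma> (icost i + icost e + 1)
    (\<sigma>\<lparr>iarr := (iarr \<sigma>)(a := (iarr \<sigma> a)(ival i \<sigma> := ival e \<sigma>))\<rparr>)"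
| RStore: "exec (RStore a i e) \<sigma> (icost i + rcost e + 1)
    (\<sigma>\<lparr>rarr := (rarr \<sigma>)(a := (rarr \<sigma> a)(ival i \<sigma> := rval e \<sigma>))\<rparr>)"
| Seq: "\<lbrakk>exec P \<sigma> T \<sigma>'; exec Q \<sigma>' U \<sigma>''\<rbrakk> \<Longrightarrow> exec (Seq P Q) \<sigma> (T + U) \<sigma>''"
| CondTrue: "\<lbrakk>bval b \<sigma>; exec P \<sigma> T \<sigma>'\<rbrakk> \<Longrightarrow> exec (Cond b P Q) \<sigma> (bcost b + T + 1) \<sigma>'"
| CondFalse: "\<lbrakk>\<not> bval b \<sigma>; exec Q \<sigma> T \<sigma>'\<rbrakk> \<Longrightarrow> exec (Cond b P Q) \<sigma> (bcost b + T + 1) \<sigma>'"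
| WhileFalse: "\<not> bval b \<sigma> \<Longrightarrow> exec (While b P) \<sigma> (bcost b + 1) \<sigma>"
| WhileTrue: "\<lbrakk>bval b \<sigma>; exec P \<sigma> T \<sigma>'; exec (While b P) \<sigma>' U \<sigma>''\<rbrakk>
    \<Longrightarrow> exec (While b P) \<sigma> (bcost b + T + U + 1) \<sigma>''"

inductive_cases exec_SkipE: "exec Skip \<sigma> T \<sigma>'"
inductive_cases exec_ISetE: "exec (ISet x e) \<sigma> T \<sigma>'"
inductive_cases exec_RSetE: "exec (RSet x e) \<sigma> T \<sigma>'"
inductive_cases exec_IStoreE: "exec (IStore a i e) \<sigma> T \<sigma>'"
inductive_cases exec_RStoreE: "exec (RStore a i e) \<sigma> T \<sigma>'"
inductive_cases exec_SeqE: "exec (Seq P Q) \<sigma> T \<sigma>'"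
inductive_cases exec_CondE: "exec (Cond b P Q) \<sigma> T \<sigma>'"
inductive_cases exec_WhileE: "exec (While b P) \<sigma> T \<sigma>'"

lemma exec_deterministic:
  "exec P \<sigma> T \<sigma>' \<Longrightarrow> exec P \<sigma> U \<sigma>'' \<Longrightarrow> U = T \<and> \<sigma>'' = \<sigma>'"
proof (induction arbitrary: U \<sigma>'' rule: exec.induct)
  case Skip then show ?case by (elim exec_SkipE) simp
next
  case ISet then show ?case by (elim exec_ISetE) simp
next
  case RSet then show ?case by (elim exec_RSetE) simp
next
  case IStore then show ?case by (elim exec_IStoreE) simp
next
  case RStore then show ?case by (elim exec_RStoreE) simp
next
  case Seq
  from Seq.prems show ?case by (rule exec_SeqE) (metis Seq.IH)
next
  case CondTrue
  from CondTrue.prems show ?case by (rule exec_CondE) (use CondTrue.hyps(1) CondTrue.IH in force)+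
next
  case CondFalse
  from CondFalse.prems show ?case by (rule exec_CondE) (use CondFalse.hyps(1) CondFalse.IH in force)+
next
  case WhileFalse
  from WhileFalse.prems show ?case by (rule exec_WhileE) (use WhileFalse.hyps(1) in simp_all)
next
  case WhileTrue
  from WhileTrue.prems show ?case
    by (rule exec_WhileE) (use WhileTrue.hyps(1) WhileTrue.IH in force)+
qed

definition halts_within :: "com \<Rightarrow> state \<Rightarrow> real \<Rightarrow> (state \<Rightarrow> bool) \<Rightarrow> bool" where
  "halts_within P \<sigma> B Q \<longleftrightarrow> (\<exists>T \<sigma>'. exec P \<sigma> T \<sigma>' \<and> real T \<le> B \<and> Q \<sigma>')"


section \<open>Representation of the input in memory\<close>

text \<open>
  The lists \<open>vs\<close>, \<open>cs\<close>, \<open>es\<close>, \<open>sel\<close> enumerate the voters, the candidates, the edges and \<open>A\<close>, each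
  in arbitrary order; a vertex is represented by its position in \<open>vs\<close> or \<open>cs\<close>. The graph is stored
  as a plain list of edges together with their weights, and the supports of the members of \<open>A\<close> are
  stored alongside \<open>A\<close>. All memory not mentioned here has arbitrary initial contents.
\<close>

definition stores ::
  "state \<Rightarrow> ('n, 'c) election \<Rightarrow> 'c set \<Rightarrow> ('n \<times> 'c \<Rightarrow> real) \<Rightarrow>
    'n list \<Rightarrow> 'c list \<Rightarrow> ('n \<times> 'c) list \<Rightarrow> 'c list \<Rightarrow> bool" where
  "stores \<sigma> I A w vs cs es sel \<longleftrightarrow>
     distinct vs \<and> set vs = voters I \<and> distinct cs \<and> set cs = cands I \<and>
     distinct es \<and> set es = edges I \<and> distinct sel \<and> set sel = A \<and>
     ivar \<sigma> ''num_voters'' = length vs \<and> ivar \<sigma> ''num_cands'' = length cs \<and>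
     ivar \<sigma> ''num_edges'' = length es \<and> ivar \<sigma> ''num_selected'' = length sel \<and>
     ivar \<sigma> ''k'' = seats I \<and>
     (\<forall>i<length vs. rarr \<sigma> ''strength'' i = strength I (vs ! i)) \<and>
     (\<forall>j<length es.
        iarr \<sigma> ''edge_voter'' j < length vs \<and> iarr \<sigma> ''edge_cand'' j < length cs \<and>
        es ! j = (vs ! iarr \<sigma> ''edge_voter'' j, cs ! iarr \<sigma> ''edge_cand'' j) \<and>
        rarr \<sigma> ''weight'' j = w (es ! j)) \<and>
     (\<forall>j<length sel.
        iarr \<sigma> ''selected'' j < length cs \<and> sel ! j = cs ! iarr \<sigma> ''selected'' j \<and>
        rarr \<sigma> ''supp'' j = supp I w (sel ! j))"

text \<open>The candidate and the number returned by a program that has halted in the given state.\<close>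

definition returns :: "state \<Rightarrow> 'c list \<Rightarrow> 'c \<Rightarrow> real \<Rightarrow> bool" where
  "returns \<sigma> cs c r \<longleftrightarrow>
     ivar \<sigma> ''result_cand'' < length cs \<and> c = cs ! ivar \<sigma> ''result_cand'' \<and>
     r = rvar \<sigma> ''result_value''"

end

theory Submission imports Defs begin

text \<open>
  For fixed \<open>t\<close>, every member \<open>c\<close> of \<open>A\<close> contributes a factor \<open>min 1 (t / supp c)\<close>; two sweeps over
  the edges turn the factors into slacks and the slacks into prescores.

  Prescores decrease in \<open>t\<close>, so \<open>t \<le> score c\<close> iff \<open>t \<le> prescore c t\<close>, and the maximum score is the
  largest \<open>t\<close> at which some prescore is at least \<open>t\<close>. After merge sorting the supports, a binary
  search driven by the first algorithm finds the largest support (or \<open>0\<close>) \<open>h\<close> not exceeding the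
  maximum score. Between \<open>h\<close> and the next support all prescores are affine in \<open>t\<close>; evaluating the
  affine functions at \<open>0\<close> and \<open>1\<close> gives their fixed points \<open>r c\<close>, which agree with \<open>score c\<close>
  whenever one of the two is at least \<open>h\<close>. Hence a maximiser of \<open>r\<close> also maximises the score.
\<close>

section \<open>Cost-bounded execution\<close>

text \<open>A score is defined implicitly: \<open>t\<close> occurs inside every minimum, so a fixed
  point cannot be read off before it is known which minima are capped. The breakpoints, however, are
  the supports of the members of \<open>A\<close> and hence common to all candidates, so a single
  search serves all of them at once. The price is that the piece found is right only for candidates
  whose score is at least \<open>h\<close>. The others may get a wrong \<open>r c\<close>, but one
  that stays below \<open>h\<close>, because affine and true prescores coincide at \<open>h\<close>.

  The logarithm arises twice, from the merge passes and from the search steps. Each of these is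
  linear in the number of edges: without isolated vertices there are at least as many edges as
  voters, candidates or members of \<open>A\<close>.

  The constant of the time bound must be fixed before the instance is known; costs are therefore a
  number read off the program text, times a factor depending on the input.\<close>

text \<open>Every loop is charged for a single iteration; the number of iterations is accounted for by the
  factor \<open>E\<close> of \<open>runs\<close>.\<close>

primrec unit_cost :: "com \<Rightarrow> nat" where
  "unit_cost Skip = 1"
| "unit_cost (ISet x e) = icost e + 1"
| "unit_cost (RSet x e) = rcost e + 1"
| "unit_cost (IStore a i e) = icost i + icost e + 1"
| "unit_cost (RStore a i e) = icost i + rcost e + 1"
| "unit_cost (Seq P Q) = unit_cost P + unit_cost Q"
| "unit_cost (Cond b P Q) = bcost b + unit_cost P + unit_cost Q + 1"
| "unit_cost (While b P) = 2 * (bcost b + 1) + unit_cost P"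

text \<open>In this product form sequential composition keeps \<open>E\<close> and adds unit costs,
  so that the rules never have to combine different bounds.\<close>

definition runs :: "nat \<Rightarrow> com \<Rightarrow> state \<Rightarrow> (state \<Rightarrow> bool) \<Rightarrow> bool" where
  "runs E P \<sigma> Q \<longleftrightarrow> (\<exists>T \<sigma>'. exec P \<sigma> T \<sigma>' \<and> T \<le> unit_cost P * E \<and> Q \<sigma>')"

section \<open>Frames: the memory that a program leaves untouched\<close>

primrec writes :: "com \<Rightarrow> string set" where
  "writes Skip = {}"
| "writes (ISet x e) = {x}"
| "writes (RSet x e) = {x}"
| "writes (IStore a i e) = {a}"
| "writes (RStore a i e) = {a}"
| "writes (Seq P Q) = writes P \<union> writes Q"
| "writes (Cond b P Q) = writes P \<union> writes Q"
| "writes (While b P) = writes P"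

text \<open>One set of names covers all four kinds of memory, so writing a register also gives up
  the array of the same name. This loses nothing, as no program below uses one name for two
  kinds.\<close>

definition agree :: "string set \<Rightarrow> state \<Rightarrow> state \<Rightarrow> bool" where
  "agree X \<sigma> \<sigma>' \<longleftrightarrow> (\<forall>x. x \<notin> X \<longrightarrow> ivar \<sigma>' x = ivar \<sigma> x \<and> rvar \<sigma>' x = rvar \<sigma> x \<and>
     iarr \<sigma>' x = iarr \<sigma> x \<and> rarr \<sigma>' x = rarr \<sigma> x)"

lemma agree_trans: "agree X \<sigma> \<sigma>' \<Longrightarrow> agree Y \<sigma>' \<sigma>'' \<Longrightarrow> agree (X \<union> Y) \<sigma> \<sigma>''"
  by (simp add: agree_def)

lemma agree_mono: "agree X \<sigma> \<sigma>' \<Longrightarrow> X \<subseteq> Y \<Longrightarrow> agree Y \<sigma> \<sigma>'"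
  by (auto simp: agree_def)

lemma agreeD:
  assumes "agree X \<sigma> \<sigma>'" "x \<notin> X"
  shows "ivar \<sigma>' x = ivar \<sigma> x" "rvar \<sigma>' x = rvar \<sigma> x" "iarr \<sigma>' x = iarr \<sigma> x" "rarr \<sigma>' x = rarr \<sigma> x"
  using assms by (auto simp: agree_def)

lemma exec_agree: "exec P \<sigma> T \<sigma>' \<Longrightarrow> agree (writes P) \<sigma> \<sigma>'"
  by (induction rule: exec.induct) (auto simp: agree_def)

lemma runs_conseq: "runs E P \<sigma> Q \<Longrightarrow> E \<le> E' \<Longrightarrow> (\<And>\<sigma>'. Q \<sigma>' \<Longrightarrow> agree (writes P) \<sigma> \<sigma>' \<Longrightarrow> R \<sigma>') \<Longrightarrow>
    runs E' P \<sigma> R"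
  unfolding runs_def by (meson exec_agree le_trans mult_le_mono2)

lemma runsI:
  assumes "exec P \<sigma> T \<sigma>'" "T \<le> unit_cost P" "1 \<le> E" "Q \<sigma>'"
  shows "runs E P \<sigma> Q"
proof -
  have "unit_cost P * 1 \<le> unit_cost P * E" using assms(3) by (intro mult_le_mono2)
  with assms show ?thesis unfolding runs_def by (metis le_trans mult.right_neutral)
qed

section \<open>Rules for assignments, sequences, branches and loops\<close>

lemma runs_Skip: "1 \<le> E \<Longrightarrow> Q \<sigma> \<Longrightarrow> runs E Skip \<sigma> Q"
  by (rule runsI, rule exec.Skip) auto

lemma runs_ISet:
  "1 \<le> E \<Longrightarrow> Q (\<sigma>\<lparr>ivar := (ivar \<sigma>)(x := ival e \<sigma>)\<rparr>) \<Longrightarrow> runs E (ISet x e) \<sigma> Q"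
  by (rule runsI, rule exec.ISet) auto

lemma runs_RSet:
  "1 \<le> E \<Longrightarrow> Q (\<sigma>\<lparr>rvar := (rvar \<sigma>)(x := rval e \<sigma>)\<rparr>) \<Longrightarrow> runs E (RSet x e) \<sigma> Q"
  by (rule runsI, rule exec.RSet) auto

lemma runs_IStore:
  "1 \<le> E \<Longrightarrow> Q (\<sigma>\<lparr>iarr := (iarr \<sigma>)(a := (iarr \<sigma> a)(ival i \<sigma> := ival e \<sigma>))\<rparr>) \<Longrightarrow>
    runs E (IStore a i e) \<sigma> Q"
  by (rule runsI, rule exec.IStore) auto

lemma runs_RStore:
  "1 \<le> E \<Longrightarrow> Q (\<sigma>\<lparr>rarr := (rarr \<sigma>)(a := (rarr \<sigma> a)(ival i \<sigma> := rval e \<sigma>))\<rparr>) \<Longrightarrow>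
    runs E (RStore a i e) \<sigma> Q"
  by (rule runsI, rule exec.RStore) auto

lemma runs_Seq: "runs E P \<sigma> (\<lambda>\<sigma>'. runs E Q \<sigma>' R) \<Longrightarrow> runs E (Seq P Q) \<sigma> R"
  unfolding runs_def by (force intro: exec.Seq simp: distrib_right)

text \<open>The second program inherits the frame of the first, so an intermediate assertion
  \<open>S\<close> only has to record what \<open>P\<close> computes.\<close>

lemma runs_SeqI:
  assumes "runs E P \<sigma> S" "\<And>\<sigma>'. S \<sigma>' \<Longrightarrow> agree (writes P) \<sigma> \<sigma>' \<Longrightarrow> runs E Q \<sigma>' R"
  shows "runs E (Seq P Q) \<sigma> R"
  using assms by (intro runs_Seq) (auto intro: runs_conseq)

lemma runs_Cond:
  assumes "1 \<le> E" "bval b \<sigma> \<Longrightarrow> runs E P \<sigma> R" "\<not> bval b \<sigma> \<Longrightarrow> runs E Q \<sigma> R"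
  shows "runs E (Cond b P Q) \<sigma> R"
proof (cases "bval b \<sigma>")
  case True
  then obtain T \<sigma>' where *: "exec P \<sigma> T \<sigma>'" "T \<le> unit_cost P * E" "R \<sigma>'"
    using assms(2) unfolding runs_def by auto
  have "(bcost b + 1) * 1 \<le> (bcost b + 1) * E" using assms(1) by (intro mult_le_mono2)
  then have "bcost b + T + 1 \<le> unit_cost (Cond b P Q) * E"
    using *(2) by (simp add: distrib_right)
  then show ?thesis unfolding runs_def using exec.CondTrue[OF True *(1)] *(3) by blast
next
  case False
  then obtain T \<sigma>' where *: "exec Q \<sigma> T \<sigma>'" "T \<le> unit_cost Q * E" "R \<sigma>'"
    using assms(3) unfolding runs_def by auto
  have "(bcost b + 1) * 1 \<le> (bcost b + 1) * E" using assms(1) by (intro mult_le_mono2)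
  then have "bcost b + T + 1 \<le> unit_cost (Cond b P Q) * E"
    using *(2) by (simp add: distrib_right)
  then show ?thesis unfolding runs_def using exec.CondFalse[OF False *(1)] *(3) by blast
qed

lemmas runs_intros = runs_Skip runs_ISet runs_RSet runs_IStore runs_RStore runs_Seq
  runs_Cond

text \<open>The number indexing \<open>Inv\<close> drops by one in every round, so there are at most
  \<open>L\<close> rounds. The factor 2 in the \<open>unit_cost\<close> of a loop pays for the
  successful tests and, separately, for the last, failing one.\<close>

lemma runs_While:
  assumes step: "\<And>v \<sigma>. Inv v \<sigma> \<Longrightarrow> bval b \<sigma> \<Longrightarrow> \<exists>u. v = Suc u \<and> runs E P \<sigma> (Inv u)"
    and init: "Inv v \<sigma>" and bound: "v \<le> L" "1 \<le> E" "1 \<le> L"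
  shows "runs (E * L) (While b P) \<sigma> (\<lambda>\<sigma>'. \<not> bval b \<sigma>' \<and> (\<exists>u. Inv u \<sigma>'))"
proof -
  have "\<exists>T \<sigma>'. exec (While b P) \<sigma> T \<sigma>' \<and> T \<le> v * (bcost b + 1 + unit_cost P * E) + (bcost b + 1) \<and>
    \<not> bval b \<sigma>' \<and> (\<exists>u. Inv u \<sigma>')"
    using init
  proof (induction v arbitrary: \<sigma>)
    case 0
    \<comment> \<open>At variant 0 a true guard would require \<open>0 = Suc u\<close>.\<close>
    then have "\<not> bval b \<sigma>" using step by fastforce
    with 0 show ?case using exec.WhileFalse[of b \<sigma> P] by fastforce
  next
    case (Suc v)
    show ?case
    proof (cases "bval b \<sigma>")
      case True
      then obtain T \<sigma>' where 1: "exec P \<sigma> T \<sigma>'" "T \<le> unit_cost P * E" "Inv v \<sigma>'"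
        using step[OF Suc.prems] unfolding runs_def by auto
      obtain U \<sigma>'' where 2: "exec (While b P) \<sigma>' U \<sigma>''"
        "U \<le> v * (bcost b + 1 + unit_cost P * E) + (bcost b + 1)" "\<not> bval b \<sigma>''" "\<exists>u. Inv u \<sigma>''"
        using Suc.IH[OF 1(3)] by blast
      then show ?thesis
        using exec.WhileTrue[OF True 1(1) 2(1)] 1(2) by fastforce
    next
      case False
      with Suc.prems show ?thesis using exec.WhileFalse[of b \<sigma> P] by fastforce
    qed
  qed
  moreover have "v * (bcost b + 1 + unit_cost P * E) + (bcost b + 1) \<le> unit_cost (While b P) * (E * L)"
  proof -
    have "v * (bcost b + 1) \<le> (E * L) * (bcost b + 1)"
      using bound by (intro mult_le_mono1) (metis le_trans mult.left_neutral mult_le_mono1)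
    moreover have "1 * (bcost b + 1) \<le> (E * L) * (bcost b + 1)"
      using bound by (intro mult_le_mono1) (simp add: Suc_le_eq)
    moreover have "v * (unit_cost P * E) \<le> L * (unit_cost P * E)"
      using bound by (intro mult_le_mono1)
    ultimately have "v * (bcost b + 1) + v * (unit_cost P * E) + 1 * (bcost b + 1)
        \<le> (E * L) * (bcost b + 1) + L * (unit_cost P * E) + (E * L) * (bcost b + 1)"
      by (intro add_mono)
    then show ?thesis by (simp add: algebra_simps)
  qed
  ultimately show ?thesis unfolding runs_def by (meson le_trans)
qed

section \<open>Counting loops\<close>

definition For :: "string \<Rightarrow> string \<Rightarrow> com \<Rightarrow> com" where
  "For i n P = Seq (ISet i (INum 0))
     (While (ILess (IVar i) (IVar n)) (Seq P (ISet i (IAdd (IVar i) (INum 1)))))"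

lemma writes_For [simp]: "writes (For i n P) = insert i (writes P)"
  by (auto simp: For_def)

text \<open>The body must run in constant time (\<open>runs 1\<close>), so that \<open>E\<close>
  only has to bound the number of rounds. Hypothesis \<open>upd\<close> makes the invariant blind to
  the counter, which is changed by initialisation and increment.\<close>

lemma runs_For:
  assumes "1 \<le> E" "ivar \<sigma> n \<le> E" "i \<noteq> n" "i \<notin> writes P" "n \<notin> writes P"
    and init: "Inv 0 \<sigma>"
    and upd: "\<And>j \<sigma>' v. Inv j \<sigma>' \<Longrightarrow> Inv j (\<sigma>'\<lparr>ivar := (ivar \<sigma>')(i := v)\<rparr>)"
    and step: "\<And>j \<sigma>'. j < ivar \<sigma> n \<Longrightarrow> ivar \<sigma>' i = j \<Longrightarrow> agree (insert i (writes P)) \<sigma> \<sigma>' \<Longrightarrow>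
      Inv j \<sigma>' \<Longrightarrow> runs 1 P \<sigma>' (Inv (Suc j))"
  shows "runs E (For i n P) \<sigma> (Inv (ivar \<sigma> n))"
proof -
  define N where "N = ivar \<sigma> n"
  \<comment> \<open>\<open>Inv\<close> counts finished rounds upwards, while
    \<open>runs_While\<close> wants a variant counting down; \<open>v + j = N\<close> converts one
    into the other.\<close>
  define J where "J = (\<lambda>v \<sigma>'. \<exists>j. v + j = N \<and> ivar \<sigma>' i = j \<and>
    agree (insert i (writes P)) \<sigma> \<sigma>' \<and> Inv j \<sigma>')"
  let ?b = "ILess (IVar i) (IVar n)"
  let ?P = "Seq P (ISet i (IAdd (IVar i) (INum 1)))"
  have n: "ivar \<sigma>' n = N" if "agree (insert i (writes P)) \<sigma> \<sigma>'" for \<sigma>'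
    using agreeD(1)[OF that] assms by (simp add: N_def)
  have "runs (1 * E) (While ?b ?P) (\<sigma>\<lparr>ivar := (ivar \<sigma>)(i := 0)\<rparr>) (\<lambda>\<sigma>'. \<not> bval ?b \<sigma>' \<and> (\<exists>u. J u \<sigma>'))"
  proof (rule runs_While[where v = N])
    fix v \<sigma>' assume "J v \<sigma>'" "bval ?b \<sigma>'"
    then obtain j where j: "v + j = N" "ivar \<sigma>' i = j" "agree (insert i (writes P)) \<sigma> \<sigma>'" "Inv j \<sigma>'"
      unfolding J_def by blast
    have "j < N" using \<open>bval ?b \<sigma>'\<close> n[OF j(3)] j(2) by simp
    then obtain u where u: "v = Suc u" using j(1) by (cases v) auto
    have "runs 1 P \<sigma>' (Inv (Suc j))"
      using step j \<open>j < N\<close> by (simp add: N_def)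
    then have "runs 1 ?P \<sigma>' (J u)"
    proof (rule runs_SeqI)
      fix \<sigma>'' assume *: "Inv (Suc j) \<sigma>''" "agree (writes P) \<sigma>' \<sigma>''"
      have a: "agree (insert i (writes P)) \<sigma> \<sigma>''"
        using agree_trans[OF j(3) *(2)] by (rule agree_mono) auto
      have "ivar \<sigma>'' i = j" using agreeD(1)[OF *(2)] assms(4) j(2) by simp
      then show "runs 1 (ISet i (IAdd (IVar i) (INum 1))) \<sigma>'' (J u)"
        using j(1) u upd[OF *(1)] a
        by (intro runs_ISet) (auto simp: J_def agree_def)
    qed
    with u show "\<exists>u. v = Suc u \<and> runs 1 ?P \<sigma>' (J u)" by blast
  next
    show "J N (\<sigma>\<lparr>ivar := (ivar \<sigma>)(i := 0)\<rparr>)"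
      using upd[OF init] by (simp add: J_def agree_def)
  qed (use assms in \<open>auto simp: N_def\<close>)
  then have "runs E (While ?b ?P) (\<sigma>\<lparr>ivar := (ivar \<sigma>)(i := 0)\<rparr>) (Inv N)"
  proof (rule runs_conseq)
    fix \<sigma>' assume "\<not> bval ?b \<sigma>' \<and> (\<exists>u. J u \<sigma>')"
    then show "Inv N \<sigma>'" using n by (auto simp: J_def)
  qed simp
  then show ?thesis
    unfolding For_def N_def using assms(1) by (intro runs_Seq runs_ISet) auto
qed

lemma runs_ForI:
  assumes step: "\<And>j \<sigma>'. j < N \<Longrightarrow> ivar \<sigma>' i = j \<Longrightarrow> agree (insert i X) \<sigma> \<sigma>' \<Longrightarrow>
      Inv j \<sigma>' \<Longrightarrow> runs 1 P \<sigma>' (Inv (Suc j))"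
    and init: "Inv 0 \<sigma>"
    and post: "\<And>\<sigma>'. Inv N \<sigma>' \<Longrightarrow> agree (insert i X) \<sigma> \<sigma>' \<Longrightarrow> Q \<sigma>'"
    and upd: "\<And>j \<sigma>' v. Inv j \<sigma>' \<Longrightarrow> Inv j (\<sigma>'\<lparr>ivar := (ivar \<sigma>')(i := v)\<rparr>)"
    and "1 \<le> E" "ivar \<sigma> n = N" "N \<le> E" "writes P = X" "i \<noteq> n" "i \<notin> X" "n \<notin> X"
  shows "runs E (For i n P) \<sigma> Q"
proof (rule runs_conseq[OF runs_For[where Inv = Inv and E = E] order_refl])
  show "Q \<sigma>'" if "Inv (ivar \<sigma> n) \<sigma>'" "agree (writes (For i n P)) \<sigma> \<sigma>'" for \<sigma>'
    using that assms by simp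
qed (use assms in auto)

text \<open>Granting \<open>e\<close> the old entry \<open>j\<close> permits updates in place: round
  \<open>j\<close> is the first to overwrite that entry.\<close>

lemma runs_For_RStore:
  assumes "\<And>j \<sigma>'. j < N \<Longrightarrow> ivar \<sigma>' i = j \<Longrightarrow> agree {i, a} \<sigma> \<sigma>' \<Longrightarrow>
      rarr \<sigma>' a j = rarr \<sigma> a j \<Longrightarrow> rval e \<sigma>' = f j"
    and "1 \<le> E" "ivar \<sigma> n = N" "N \<le> E" "i \<noteq> n" "i \<noteq> a" "n \<noteq> a"
  shows "runs E (For i n (RStore a (IVar i) e)) \<sigma> (\<lambda>\<sigma>'. \<forall>j<N. rarr \<sigma>' a j = f j)"
proof (rule runs_ForI[where N = N and X = "{a}" and
      Inv = "\<lambda>j \<sigma>'. \<forall>l. rarr \<sigma>' a l = (if l < j then f l else rarr \<sigma> a l)"], goal_cases)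
  case (1 j \<sigma>')
  then have "rval e \<sigma>' = f j" by (intro assms(1)) auto
  with 1 show ?case by (auto intro!: runs_RStore)
qed (use assms in auto)

lemma halts_within_runs:
  assumes "runs E P \<sigma> Q" "real (unit_cost P * E) \<le> B" "\<And>\<sigma>'. Q \<sigma>' \<Longrightarrow> R \<sigma>'"
  shows "halts_within P \<sigma> B R"
  using assms unfolding runs_def halts_within_def by (meson of_nat_le_iff order_trans)

section \<open>Prescores and scores\<close>

text \<open>The prescore with the minimum in the slack resolved by comparing supports with \<open>h\<close> instead
  of \<open>t\<close>. It is affine in \<open>t\<close> and coincides with the prescore for \<open>t\<close> between \<open>h\<close> and the next
  larger support.\<close>

definition affine_prescore ::
  "('n, 'c) election \<Rightarrow> 'c set \<Rightarrow> ('n \<times> 'c \<Rightarrow> real) \<Rightarrow> real \<Rightarrow> 'c \<Rightarrow> real \<Rightarrow> real" where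
  "affine_prescore I A w h c t = (\<Sum>n\<in>voters_of I c. strength I n -
     (\<Sum>c'\<in>A \<inter> cands_of I n. w (n, c') * (if supp I w c' \<le> h then 1 else t / supp I w c')))"

section \<open>Elementary facts about a partial solution\<close>

locale solution =
  fixes I :: "('n, 'c) election" and A w
  assumes instance_I: "election_instance I" and solution_A: "partial_solution I A w"
begin

lemma finite_edges: "finite (edges I)"
  using instance_I unfolding election_instance_def by (meson finite_SigmaI finite_subset)

lemma finite_voters_of [simp]: "finite (voters_of I c)"
  unfolding voters_of_def by (rule finite_subset[OF _ finite_imageI[OF finite_edges, of fst]]) force

lemma finite_cands_of [simp]: "finite (cands_of I n)"
  unfolding cands_of_def by (rule finite_subset[OF _ finite_imageI[OF finite_edges, of snd]]) force

lemma finite_cands: "finite (cands I)" and finite_A: "finite A" and A_subset: "A \<subseteq> cands I"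
  using instance_I solution_A
  by (auto simp: election_instance_def partial_solution_def intro: finite_subset)

lemma weight_nonneg: "n \<in> voters_of I c \<Longrightarrow> 0 \<le> w (n, c)"
  using solution_A by (auto simp: partial_solution_def feasible_def voters_of_def)

lemma voters_of_iff_cands_of: "n \<in> voters_of I c \<longleftrightarrow> c \<in> cands_of I n"
  by (simp add: voters_of_def cands_of_def)

lemma strength_nonneg: "n \<in> voters_of I c \<Longrightarrow> 0 \<le> strength I n"
  using instance_I by (auto simp: election_instance_def voters_of_def)

lemma supp_nonneg: "0 \<le> supp I w c"
  unfolding supp_def by (intro sum_nonneg weight_nonneg)

text \<open>Makes zero supports harmless. There \<open>slack\<close> uses the factor
  \<open>min 1 (t / 0) = 0\<close> and \<open>affine_prescore\<close> with \<open>0 \<le> h\<close>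
  the factor 1, but both multiply a vanishing weight.\<close>

lemma weight_eq_0:
  assumes "supp I w c = 0" "n \<in> voters_of I c" shows "w (n, c) = 0"
  using assms sum_nonneg_eq_0_iff[of "voters_of I c" "\<lambda>n. w (n, c)"] weight_nonneg
  by (auto simp: supp_def)

lemma unselected_nonempty: "cands I - A \<noteq> {}"
proof
  assume "cands I - A = {}"
  then have "card (cands I) \<le> card A" using finite_A by (intro card_mono) auto
  then show False using instance_I solution_A
    by (auto simp: election_instance_def partial_solution_def)
qed

text \<open>At a positive support equal to \<open>t\<close> the quotient is 1 anyway, so the
  interval may be closed on the right. For \<open>h = t\<close> the third hypothesis is a tautology,
  which yields plain prescores at a threshold.\<close>

lemma affine_prescore_eq_prescore:
  assumes "0 \<le> h" "h \<le> t" "\<And>c'. c' \<in> A \<Longrightarrow> supp I w c' \<le> h \<or> t \<le> supp I w c'"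
  shows "affine_prescore I A w h c t = prescore I A w c t"
proof -
  have "w (n, c') * (if supp I w c' \<le> h then 1 else t / supp I w c') = w (n, c') * min 1 (t / supp I w c')"
    if "c' \<in> A" "c' \<in> cands_of I n" for n c'
  proof (cases "supp I w c' = 0")
    case True
    then show ?thesis using weight_eq_0[of c' n] that by (simp add: voters_of_iff_cands_of)
  next
    case False
    then have "0 < supp I w c'" using supp_nonneg[of c'] by simp
    then show ?thesis using assms(1,2) assms(3)[OF that(1)] by (auto simp: min_def field_simps)
  qed
  then show ?thesis
    unfolding affine_prescore_def prescore_def slack_def
    by (intro sum.cong refl arg_cong2[where f = minus]) auto
qed

text \<open>Two evaluations, at 0 and at 1, capture the whole line; the bracketed difference is
  minus its slope.\<close>

lemma affine_prescore_eq:
  "affine_prescore I A w h c t =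
     affine_prescore I A w h c 0 - t * (affine_prescore I A w h c 0 - affine_prescore I A w h c 1)"
proof -
  \<comment> \<open>\<open>a\<close> is the constant part of a summand and \<open>b\<close> its
    coefficient of \<open>t\<close>.\<close>
  define a where "a n c' = w (n, c') * (if supp I w c' \<le> h then 1 else 0)" for n c'
  define b where "b n c' = w (n, c') * (if supp I w c' \<le> h then 0 else 1 / supp I w c')" for n c'
  have "w (n, c') * (if supp I w c' \<le> h then 1 else x / supp I w c') = a n c' + x * b n c'" for n c' x
    by (simp add: a_def b_def)
  then have "affine_prescore I A w h c x =
      (\<Sum>n\<in>voters_of I c. strength I n - (\<Sum>c'\<in>A \<inter> cands_of I n. a n c')) -
      x * (\<Sum>n\<in>voters_of I c. \<Sum>c'\<in>A \<inter> cands_of I n. b n c')" for x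
    by (simp add: affine_prescore_def sum.distrib sum_subtractf sum_distrib_left)
  from this[of t] this[of 0] this[of 1] show ?thesis by simp
qed

lemma affine_prescore_antimono:
  assumes "s \<le> t" shows "affine_prescore I A w h c t \<le> affine_prescore I A w h c s"
  unfolding affine_prescore_def
  using assms supp_nonneg weight_nonneg
  by (intro sum_mono diff_left_mono mult_left_mono)
     (auto simp: voters_of_iff_cands_of divide_right_mono)

section \<open>Scores as fixed points of decreasing functions\<close>

lemma prescore_antimono:
  assumes "s \<le> t" shows "prescore I A w c t \<le> prescore I A w c s"
  unfolding prescore_def slack_def
  using assms supp_nonneg weight_nonneg
  by (intro sum_mono diff_left_mono mult_left_mono min.mono)
     (auto simp: voters_of_iff_cands_of divide_right_mono)

lemma prescore_0: "0 \<le> prescore I A w c 0"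
  unfolding prescore_def slack_def by (auto intro!: sum_nonneg strength_nonneg)

lemma continuous_prescore: "continuous_on S (prescore I A w c)"
proof -
  \<comment> \<open>Multiplying by a constant inverse is continuous even at support 0, whereas the
    rule for quotients asks for a nonzero denominator.\<close>
  have "prescore I A w c = (\<lambda>t. \<Sum>n\<in>voters_of I c. strength I n -
      (\<Sum>c'\<in>A \<inter> cands_of I n. w (n, c') * min 1 (t * inverse (supp I w c'))))"
    by (intro ext) (simp add: prescore_def slack_def divide_inverse)
  then show ?thesis by (auto intro!: continuous_intros)
qed

text \<open>\<open>GREATEST\<close> is informative only once the maximum is known to exist. As
  \<open>t\<close> minus the prescore is continuous and strictly increasing, its zero is that
  maximum.\<close>

lemma prescore_fixpoint:
  obtains t where "0 \<le> t" "prescore I A w c t = t" "score I A w c = t"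
proof -
  let ?f = "\<lambda>t. t - prescore I A w c t" and ?b = "prescore I A w c 0"
  \<comment> \<open>The sign changes on the interval from 0 to \<open>?b\<close>: the prescore is
    nonnegative at 0, and at \<open>?b\<close> it is at most its value \<open>?b\<close> at
    0.\<close>
  have "\<exists>t. 0 \<le> t \<and> t \<le> ?b \<and> ?f t = 0"
    using prescore_0[of c] prescore_antimono[of 0 ?b c]
    by (intro IVT' continuous_intros continuous_prescore) auto
  then obtain t where t: "0 \<le> t" "prescore I A w c t = t" by auto
  have "score I A w c = t"
    unfolding score_def
  proof (rule Greatest_equality)
    fix y assume "0 \<le> y \<and> y \<le> prescore I A w c y"
    then show "y \<le> t" using prescore_antimono[of t y c] t by (cases "y \<le> t") auto
  qed (use t in auto)
  with t that show thesis by blast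
qed

lemma prescore_score: "prescore I A w c (score I A w c) = score I A w c"
  using prescore_fixpoint by metis

text \<open>By monotonicity, one evaluation of a prescore compares a number with a score that is
  still unknown. The binary search rests on this.\<close>

lemma le_score_iff: "t \<le> score I A w c \<longleftrightarrow> t \<le> prescore I A w c t"
proof
  assume "t \<le> score I A w c"
  then show "t \<le> prescore I A w c t"
    using prescore_antimono[of t "score I A w c" c] prescore_score[of c] by simp
next
  assume "t \<le> prescore I A w c t"
  then show "t \<le> score I A w c"
    using prescore_antimono[of "score I A w c" t c] prescore_score[of c]
    by (cases "t \<le> score I A w c") auto
qed

text \<open>The zero of \<open>t \<mapsto> affine_prescore I A w h c t - t\<close>.\<close>

definition affine_score :: "real \<Rightarrow> 'c \<Rightarrow> real" where
  "affine_score h c = affine_prescore I A w h c 0 /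
     (1 + (affine_prescore I A w h c 0 - affine_prescore I A w h c 1))"

text \<open>The denominator of \<open>affine_score\<close> is one minus a nonpositive slope, hence
  at least 1, and multiplying by it preserves inequalities. This is the affine analogue of
  \<open>le_score_iff\<close>.\<close>

lemma le_affine_score_iff: "t \<le> affine_score h c \<longleftrightarrow> t \<le> affine_prescore I A w h c t"
proof -
  have "0 < 1 + (affine_prescore I A w h c 0 - affine_prescore I A w h c 1)"
    using affine_prescore_antimono[of 0 1 h c] by simp
  then show ?thesis
    unfolding affine_score_def affine_prescore_eq[of h c t] by (simp add: pos_le_divide_eq algebra_simps)
qed

text \<open>\<open>c0\<close> witnesses that the maximal score is at least \<open>h\<close>, and by
  \<open>next_supp\<close> no score reaches a support above \<open>h\<close>. So every score that is
  at least \<open>h\<close> lies on the piece where the affine prescore is exact, and smaller ones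
  cannot win.\<close>

lemma affine_score_argmax:
  assumes h: "0 \<le> h" "c0 \<in> cands I - A" "h \<le> prescore I A w c0 h"
    and next_supp: "\<And>c' c. c' \<in> A \<Longrightarrow> c \<in> cands I - A \<Longrightarrow> h < supp I w c' \<Longrightarrow>
      prescore I A w c (supp I w c') < supp I w c'"
    and c: "c \<in> cands I - A" "\<And>c'. c' \<in> cands I - A \<Longrightarrow> affine_score h c' \<le> affine_score h c"
  shows "affine_score h c = score I A w c"
    "score I A w c = Max (score I A w ` (cands I - A))"
proof -
  have at_h: "affine_prescore I A w h c' h = prescore I A w c' h" for c'
    using h(1) by (intro affine_prescore_eq_prescore) auto
  have eq: "affine_score h c' = score I A w c'" if "c' \<in> cands I - A" "h \<le> score I A w c'" for c'
  proof -
    let ?s = "score I A w c'"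
    have upper: "supp I w d \<le> h \<or> ?s < supp I w d" if "d \<in> A" for d
      using next_supp[OF that \<open>c' \<in> cands I - A\<close>] le_score_iff[of "supp I w d" c'] by force
    then have "affine_prescore I A w h c' ?s = ?s"
      using h(1) that(2) prescore_score[of c'] by (subst affine_prescore_eq_prescore) force+
    moreover have "affine_score h c' \<le> ?s" 
    proof (rule ccontr)
      assume "\<not> affine_score h c' \<le> ?s"
      then have "affine_score h c' \<le> affine_prescore I A w h c' ?s"
        using le_affine_score_iff[of "affine_score h c'" h c']
          affine_prescore_antimono[of ?s "affine_score h c'" h c'] by simp
      with calculation \<open>\<not> affine_score h c' \<le> ?s\<close> show False by simp
    qed
    ultimately show ?thesis using le_affine_score_iff[of ?s h c'] by simp
  qed
  \<comment> \<open>Which side of \<open>h\<close> a fixed point lies on is decided by the prescore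
    at \<open>h\<close>, where both notions agree; wrong values therefore stay below
    \<open>h\<close>.\<close>
  have h_le: "h \<le> score I A w c' \<longleftrightarrow> h \<le> affine_score h c'" for c'
    by (simp add: le_score_iff le_affine_score_iff at_h)
  have "h \<le> affine_score h c0" using h(3) by (simp add: le_affine_score_iff at_h)
  then have "h \<le> affine_score h c" using c(2)[OF h(2)] by simp
  then show s: "affine_score h c = score I A w c" using eq[OF c(1)] h_le[of c] by blast
  have "score I A w c' \<le> score I A w c" if "c' \<in> cands I - A" for c'
  proof (cases "h \<le> score I A w c'")
    case True
    then show ?thesis using eq[OF that] c(2)[OF that] s by simp
  next
    case False
    then show ?thesis using \<open>h \<le> affine_score h c\<close> s by simp
  qed
  then show "score I A w c = Max (score I A w ` (cands I - A))"
    using c(1) finite_cands by (intro Max_eqI[symmetric]) auto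
qed

end

section \<open>Computing all prescores at a threshold\<close>

text \<open>The default 0 silences edges at unselected candidates, so the sweep over the edges needs
  no test for membership in \<open>A\<close>. With \<open>h\<close> nonnegative, the division is
  reached only for positive supports.\<close>

definition factors_com :: com where
  "factors_com =
     Seq (For ''i'' ''num_cands'' (RStore ''factor'' (IVar ''i'') (RNum 0)))
     (For ''i'' ''num_selected''
       (Cond (RLess (RVar ''h'') (RArr ''supp'' (IVar ''i'')))
         (RStore ''factor'' (IArr ''selected'' (IVar ''i'')) (RDiv (RVar ''t'') (RArr ''supp'' (IVar ''i''))))
         (RStore ''factor'' (IArr ''selected'' (IVar ''i'')) (RNum 1))))"

definition slacks_com :: com where
  "slacks_com =
     Seq (For ''i'' ''num_voters'' (RStore ''slack'' (IVar ''i'') (RArr ''strength'' (IVar ''i''))))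
     (For ''i'' ''num_edges''
       (RStore ''slack'' (IArr ''edge_voter'' (IVar ''i''))
         (RSub (RArr ''slack'' (IArr ''edge_voter'' (IVar ''i'')))
           (RMul (RArr ''weight'' (IVar ''i'')) (RArr ''factor'' (IArr ''edge_cand'' (IVar ''i'')))))))"

definition sums_com :: com where
  "sums_com =
     Seq (For ''i'' ''num_cands'' (RStore ''prescore'' (IVar ''i'') (RNum 0)))
     (For ''i'' ''num_edges''
       (RStore ''prescore'' (IArr ''edge_cand'' (IVar ''i''))
         (RAdd (RArr ''prescore'' (IArr ''edge_cand'' (IVar ''i'')))
           (RArr ''slack'' (IArr ''edge_voter'' (IVar ''i''))))))"

text \<open>Keeping the comparison value \<open>h\<close> apart from the point of evaluation
  \<open>t\<close> lets one program serve both purposes: prescores at a threshold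
  (\<open>h = t\<close>) and values of one affine piece at 0 and 1.\<close>

definition prescores_com :: com where
  "prescores_com = Seq factors_com (Seq slacks_com sums_com)"

lemma writes_prescores_com:
  "writes factors_com = {''i'', ''factor''}" "writes slacks_com = {''i'', ''slack''}"
  "writes sums_com = {''i'', ''prescore''}"
  "writes prescores_com = {''i'', ''factor'', ''slack'', ''prescore''}"
  by (auto simp: factors_com_def slacks_com_def sums_com_def prescores_com_def)

definition inputs :: "string set" where
  "inputs = {''num_voters'', ''num_cands'', ''num_edges'', ''num_selected'', ''k'', ''strength'',
     ''edge_voter'', ''edge_cand'', ''weight'', ''selected'', ''supp''}"

lemma stores_agree:
  assumes "stores \<sigma> I A w vs cs es sel" "agree X \<sigma> \<sigma>'" "X \<inter> inputs = {}"
  shows "stores \<sigma>' I A w vs cs es sel"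
proof -
  have "x \<notin> X" if "x \<in> inputs" for x using assms(3) that by blast
  then show ?thesis
    using assms(1) agreeD[OF assms(2)] unfolding stores_def inputs_def by simp
qed

lemma storesD:
  assumes "stores \<sigma> I A w vs cs es sel"
  shows "distinct vs" "set vs = voters I" "distinct cs" "set cs = cands I"
    "distinct es" "set es = edges I" "distinct sel" "set sel = A"
    "ivar \<sigma> ''num_voters'' = length vs" "ivar \<sigma> ''num_cands'' = length cs"
    "ivar \<sigma> ''num_edges'' = length es" "ivar \<sigma> ''num_selected'' = length sel"
    "i < length vs \<Longrightarrow> rarr \<sigma> ''strength'' i = strength I (vs ! i)"
    "j < length es \<Longrightarrow> iarr \<sigma> ''edge_voter'' j < length vs"
    "j < length es \<Longrightarrow> iarr \<sigma> ''edge_cand'' j < length cs"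
    "j < length es \<Longrightarrow> vs ! iarr \<sigma> ''edge_voter'' j = fst (es ! j)"
    "j < length es \<Longrightarrow> cs ! iarr \<sigma> ''edge_cand'' j = snd (es ! j)"
    "j < length es \<Longrightarrow> rarr \<sigma> ''weight'' j = w (es ! j)"
    "q < length sel \<Longrightarrow> iarr \<sigma> ''selected'' q < length cs"
    "q < length sel \<Longrightarrow> cs ! iarr \<sigma> ''selected'' q = sel ! q"
    "q < length sel \<Longrightarrow> rarr \<sigma> ''supp'' q = supp I w (sel ! q)"
  using assms unfolding stores_def by (auto dest!: spec)

lemma sum_nth_eq_sum:
  assumes "distinct xs"
  shows "(\<Sum>l<length xs. g (xs ! l)) = sum g (set xs)"
  using sum.reindex_bij_betw[OF bij_betw_nth[OF assms refl refl]] by simp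

context solution
begin

text \<open>The edge list comes in arbitrary order, so a sweep is first described by a sum over all
  edges with an indicator; grouping by endpoint turns it into a sum over neighbours.\<close>

lemma sum_edges_voter:
  "(\<Sum>e\<in>edges I. if fst e = n then g e else (0::real)) = (\<Sum>c\<in>cands_of I n. g (n, c))"
proof -
  have "(\<Sum>e\<in>edges I. if fst e = n then g e else 0) = sum g {e \<in> edges I. fst e = n}"
    using finite_edges by (simp add: sum.inter_filter)
  also have "\<dots> = (\<Sum>c\<in>cands_of I n. g (n, c))"
    by (rule sum.reindex_bij_witness[where i = "Pair n" and j = snd]) (auto simp: cands_of_def)
  finally show ?thesis .
qed

lemma sum_edges_cand:
  "(\<Sum>e\<in>edges I. if snd e = c then g e else (0::real)) = (\<Sum>n\<in>voters_of I c. g (n, c))"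
proof -
  have "(\<Sum>e\<in>edges I. if snd e = c then g e else 0) = sum g {e \<in> edges I. snd e = c}"
    using finite_edges by (simp add: sum.inter_filter)
  also have "\<dots> = (\<Sum>n\<in>voters_of I c. g (n, c))"
    by (rule sum.reindex_bij_witness[where i = "\<lambda>n. (n, c)" and j = fst]) (auto simp: voters_of_def)
  finally show ?thesis .
qed

text \<open>Every vertex is an endpoint of some edge, so mapping edges to endpoints is onto on
  either side. All loops thus fit into the number of edges, and its positivity absorbs constant
  costs.\<close>

lemma stores_bounds:
  assumes "stores \<sigma> I A w vs cs es sel"
  shows "length vs \<le> length es" "length cs \<le> length es" "length sel \<le> length es" "1 \<le> length es"
proof -
  note s = storesD[OF assms]
  have "voters I \<subseteq> fst ` edges I" "cands I \<subseteq> snd ` edges I"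
    using instance_I by (force simp: election_instance_def)+
  then have "card (voters I) \<le> card (edges I)" "card (cands I) \<le> card (edges I)"
    using finite_edges by (meson surj_card_le)+
  then show "length vs \<le> length es" and cs: "length cs \<le> length es"
    using s by (metis distinct_card)+
  have "card A \<le> card (cands I)" using A_subset finite_cands by (rule card_mono[rotated])
  then show "length sel \<le> length es" using cs s by (metis distinct_card le_trans)
  have "card (cands I) \<noteq> 0" using unselected_nonempty finite_cands by auto
  then show "1 \<le> length es" using cs distinct_card[OF s(3)] unfolding s(4) by linarith
qed

definition factor :: "real \<Rightarrow> real \<Rightarrow> 'c \<Rightarrow> real" where
  "factor h t c = (if c \<in> A then if supp I w c \<le> h then 1 else t / supp I w c else 0)"

lemma factors_com:
  assumes st: "stores \<sigma> I A w vs cs es sel"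
  shows "runs (length es) factors_com \<sigma> (\<lambda>\<sigma>'. \<forall>c<length cs.
    rarr \<sigma>' ''factor'' c = factor (rvar \<sigma> ''h'') (rvar \<sigma> ''t'') (cs ! c))"
  unfolding factors_com_def
proof (rule runs_SeqI[where S = "\<lambda>\<sigma>'. \<forall>c<length cs. rarr \<sigma>' ''factor'' c = 0"], goal_cases)
  case 1
  then show ?case
    using storesD[OF st] stores_bounds[OF st] by (intro runs_For_RStore) auto
next
  case (2 \<sigma>1)
  then have a: "agree {''i'', ''factor''} \<sigma> \<sigma>1" by simp
  have st1: "stores \<sigma>1 I A w vs cs es sel" using stores_agree[OF st a] by (simp add: inputs_def)
  note s = storesD[OF st1] and b = stores_bounds[OF st1]
  let ?f = "factor (rvar \<sigma> ''h'') (rvar \<sigma> ''t'')"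
  define Inv :: "nat \<Rightarrow> state \<Rightarrow> bool" where "Inv j \<sigma>' \<longleftrightarrow> (\<forall>c<length cs. rarr \<sigma>' ''factor'' c =
    (if cs ! c \<in> set (take j sel) then ?f (cs ! c) else 0))" for j \<sigma>'
  show ?case
  proof (rule runs_ForI[where Inv = Inv and N = "length sel" and X = "{''factor''}"], goal_cases)
    case (1 j \<sigma>')
    have st': "stores \<sigma>' I A w vs cs es sel" using stores_agree[OF st1 1(3)] by (simp add: inputs_def)
    note s' = storesD[OF st']
    have ht: "rvar \<sigma>' ''h'' = rvar \<sigma> ''h''" "rvar \<sigma>' ''t'' = rvar \<sigma> ''t''"
      using agreeD[OF 1(3)] agreeD[OF a] by auto
    \<comment> \<open>As \<open>cs\<close> is distinct, the store hits the entry of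
      \<open>sel ! j\<close> and no other.\<close>
    have eq: "c = iarr \<sigma>' ''selected'' j \<longleftrightarrow> cs ! c = sel ! j" if "c < length cs" for c
      using s'(19,20)[OF 1(1)] s'(3) that by (metis nth_eq_iff_index_eq)
    have A: "sel ! j \<in> A" using s'(8) 1(1) by auto
    show ?case
      using 1(1,2,4) s'(21)[OF 1(1)] ht A eq
      by (auto simp: Inv_def take_Suc_conv_app_nth factor_def intro!: runs_intros)
  qed (use s b 2 in \<open>auto simp: Inv_def factor_def\<close>)
qed

lemma slacks_com:
  assumes st: "stores \<sigma> I A w vs cs es sel" and \<phi>: "\<forall>c<length cs. rarr \<sigma> ''factor'' c = \<phi> (cs ! c)"
  shows "runs (length es) slacks_com \<sigma> (\<lambda>\<sigma>'. \<forall>i<length vs.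
    rarr \<sigma>' ''slack'' i = strength I (vs ! i) - (\<Sum>c\<in>cands_of I (vs ! i). w (vs ! i, c) * \<phi> c))"
  unfolding slacks_com_def
proof (rule runs_SeqI[where S = "\<lambda>\<sigma>'. \<forall>i<length vs. rarr \<sigma>' ''slack'' i = strength I (vs ! i)"], goal_cases)
  case 1
  then show ?case
    using storesD[OF st] stores_bounds[OF st] by (intro runs_For_RStore) (auto simp: agree_def)
next
  case (2 \<sigma>1)
  then have a: "agree {''i'', ''slack''} \<sigma> \<sigma>1" by simp
  have st1: "stores \<sigma>1 I A w vs cs es sel" using stores_agree[OF st a] by (simp add: inputs_def)
  note s = storesD[OF st1] and b = stores_bounds[OF st1]
  let ?g = "\<lambda>e. w e * \<phi> (snd e)"
  define Inv :: "nat \<Rightarrow> state \<Rightarrow> bool" where "Inv j \<sigma>' \<longleftrightarrow> (\<forall>i<length vs. rarr \<sigma>' ''slack'' i =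
    strength I (vs ! i) - (\<Sum>l<j. if fst (es ! l) = vs ! i then ?g (es ! l) else 0))" for j \<sigma>'
  show ?case
  proof (rule runs_ForI[where Inv = Inv and N = "length es" and X = "{''slack''}"], goal_cases)
    case (1 j \<sigma>')
    have st': "stores \<sigma>' I A w vs cs es sel" using stores_agree[OF st1 1(3)] by (simp add: inputs_def)
    note s' = storesD[OF st']
    have "rarr \<sigma>' ''factor'' (iarr \<sigma>' ''edge_cand'' j) = \<phi> (snd (es ! j))"
      using agreeD[OF 1(3)] agreeD[OF a] \<phi> s'(15,17)[OF 1(1)] by simp
    moreover have "i = iarr \<sigma>' ''edge_voter'' j \<longleftrightarrow> fst (es ! j) = vs ! i" if "i < length vs" for i
      using s'(14,16)[OF 1(1)] s'(1) that by (metis nth_eq_iff_index_eq)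
    ultimately show ?case
      using 1(1,2,4) s'(14,16,18)[OF 1(1)]
      by (auto simp: Inv_def intro!: runs_intros)
  next
    case (3 \<sigma>')
    have "(\<Sum>l<length es. if fst (es ! l) = n then ?g (es ! l) else 0) = (\<Sum>c\<in>cands_of I n. w (n, c) * \<phi> c)" for n
      using sum_nth_eq_sum[OF s(5), of "\<lambda>e. if fst e = n then ?g e else 0"] s(6)
      by (simp add: sum_edges_voter)
    then show ?case using 3(1) by (simp add: Inv_def)
  qed (use s b 2 in \<open>auto simp: Inv_def\<close>)
qed

lemma sums_com:
  assumes st: "stores \<sigma> I A w vs cs es sel" and \<phi>: "\<forall>i<length vs. rarr \<sigma> ''slack'' i = \<phi> (vs ! i)"
  shows "runs (length es) sums_com \<sigma> (\<lambda>\<sigma>'. \<forall>c<length cs.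
    rarr \<sigma>' ''prescore'' c = (\<Sum>n\<in>voters_of I (cs ! c). \<phi> n))"
  unfolding sums_com_def
proof (rule runs_SeqI[where S = "\<lambda>\<sigma>'. \<forall>c<length cs. rarr \<sigma>' ''prescore'' c = 0"], goal_cases)
  case 1
  then show ?case
    using storesD[OF st] stores_bounds[OF st] by (intro runs_For_RStore) auto
next
  case (2 \<sigma>1)
  then have a: "agree {''i'', ''prescore''} \<sigma> \<sigma>1" by simp
  have st1: "stores \<sigma>1 I A w vs cs es sel" using stores_agree[OF st a] by (simp add: inputs_def)
  note s = storesD[OF st1] and b = stores_bounds[OF st1]
  let ?g = "\<lambda>e. \<phi> (fst e)"
  define Inv :: "nat \<Rightarrow> state \<Rightarrow> bool" where "Inv j \<sigma>' \<longleftrightarrow> (\<forall>c<length cs. rarr \<sigma>' ''prescore'' c =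
    (\<Sum>l<j. if snd (es ! l) = cs ! c then ?g (es ! l) else 0))" for j \<sigma>'
  show ?case
  proof (rule runs_ForI[where Inv = Inv and N = "length es" and X = "{''prescore''}"], goal_cases)
    case (1 j \<sigma>')
    have st': "stores \<sigma>' I A w vs cs es sel" using stores_agree[OF st1 1(3)] by (simp add: inputs_def)
    note s' = storesD[OF st']
    have "rarr \<sigma>' ''slack'' (iarr \<sigma>' ''edge_voter'' j) = \<phi> (fst (es ! j))"
      using agreeD[OF 1(3)] agreeD[OF a] \<phi> s'(14,16)[OF 1(1)] by simp
    moreover have "c = iarr \<sigma>' ''edge_cand'' j \<longleftrightarrow> snd (es ! j) = cs ! c" if "c < length cs" for c
      using s'(15,17)[OF 1(1)] s'(3) that by (metis nth_eq_iff_index_eq)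
    ultimately show ?case
      using 1(1,2,4) s'(15,17)[OF 1(1)]
      by (auto simp: Inv_def intro!: runs_intros)
  next
    case (3 \<sigma>')
    have "(\<Sum>l<length es. if snd (es ! l) = c then ?g (es ! l) else 0) = (\<Sum>n\<in>voters_of I c. \<phi> n)" for c
      using sum_nth_eq_sum[OF s(5), of "\<lambda>e. if snd e = c then ?g e else 0"] s(6)
      by (simp add: sum_edges_cand)
    then show ?case using 3(1) by (simp add: Inv_def)
  qed (use s b 2 in \<open>auto simp: Inv_def\<close>)
qed

lemma prescores_com:
  assumes st: "stores \<sigma> I A w vs cs es sel"
  shows "runs (length es) prescores_com \<sigma> (\<lambda>\<sigma>'. \<forall>c<length cs.
    rarr \<sigma>' ''prescore'' c = affine_prescore I A w (rvar \<sigma> ''h'') (cs ! c) (rvar \<sigma> ''t''))"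
  unfolding prescores_com_def
proof (rule runs_SeqI[OF factors_com[OF st]])
  fix \<sigma>1
  let ?f = "factor (rvar \<sigma> ''h'') (rvar \<sigma> ''t'')"
  assume 1: "\<forall>c<length cs. rarr \<sigma>1 ''factor'' c = ?f (cs ! c)" "agree (writes factors_com) \<sigma> \<sigma>1"
  have st1: "stores \<sigma>1 I A w vs cs es sel"
    using stores_agree[OF st 1(2)] by (simp add: inputs_def writes_prescores_com)
  let ?S = "\<lambda>n. strength I n - (\<Sum>c\<in>cands_of I n. w (n, c) * ?f c)"
  show "runs (length es) (Seq slacks_com sums_com) \<sigma>1 (\<lambda>\<sigma>'. \<forall>c<length cs.
    rarr \<sigma>' ''prescore'' c = affine_prescore I A w (rvar \<sigma> ''h'') (cs ! c) (rvar \<sigma> ''t''))"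
  proof (rule runs_SeqI[OF slacks_com[OF st1 1(1)]])
    fix \<sigma>2
    assume 2: "\<forall>i<length vs. rarr \<sigma>2 ''slack'' i = ?S (vs ! i)" "agree (writes slacks_com) \<sigma>1 \<sigma>2"
    have st2: "stores \<sigma>2 I A w vs cs es sel"
      using stores_agree[OF st1 2(2)] by (simp add: inputs_def writes_prescores_com)
    \<comment> \<open>The factor is 0 outside \<open>A\<close>, so the sum over all neighbours
      shrinks to those in \<open>A\<close>.\<close>
    have "(\<Sum>c\<in>cands_of I n. w (n, c) * ?f c) = (\<Sum>c\<in>A \<inter> cands_of I n. w (n, c) *
        (if supp I w c \<le> rvar \<sigma> ''h'' then 1 else rvar \<sigma> ''t'' / supp I w c))" for n
      by (rule sum.mono_neutral_cong_right) (auto simp: factor_def)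
    then have "(\<Sum>n\<in>voters_of I c. ?S n) = affine_prescore I A w (rvar \<sigma> ''h'') c (rvar \<sigma> ''t'')" for c
      by (simp add: affine_prescore_def)
    then show "runs (length es) sums_com \<sigma>2 (\<lambda>\<sigma>'. \<forall>c<length cs.
      rarr \<sigma>' ''prescore'' c = affine_prescore I A w (rvar \<sigma> ''h'') (cs ! c) (rvar \<sigma> ''t''))"
      using runs_conseq[OF sums_com[OF st2 2(1)] order_refl] by simp
  qed
qed

end

section \<open>Maximising over the unselected candidates\<close>

definition taken_com :: com where
  "taken_com =
     Seq (For ''i'' ''num_cands'' (IStore ''taken'' (IVar ''i'') (INum 0)))
     (For ''i'' ''num_selected'' (IStore ''taken'' (IArr ''selected'' (IVar ''i'')) (INum 1)))"

text \<open>The index \<open>num_cands\<close> stands for the absence of a best candidate so far.\<close>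

definition argmax_com :: com where
  "argmax_com =
     Seq (ISet ''result_cand'' (IVar ''num_cands''))
     (For ''i'' ''num_cands''
       (Cond (BAnd (ILess (IArr ''taken'' (IVar ''i'')) (INum 1))
           (BNot (BAnd (ILess (IVar ''result_cand'') (IVar ''num_cands''))
             (BNot (RLess (RVar ''result_value'') (RArr ''value'' (IVar ''i'')))))))
         (Seq (ISet ''result_cand'' (IVar ''i'')) (RSet ''result_value'' (RArr ''value'' (IVar ''i''))))
         Skip))"

definition select_com :: com where
  "select_com = Seq taken_com argmax_com"

definition threshold_com :: com where
  "threshold_com = Seq (RSet ''h'' (RVar ''t'')) (Seq prescores_com
     (Seq (For ''i'' ''num_cands'' (RStore ''value'' (IVar ''i'') (RArr ''prescore'' (IVar ''i''))))
       select_com))"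

lemma writes_select_com:
  "writes taken_com = {''i'', ''taken''}"
  "writes argmax_com = {''i'', ''result_cand'', ''result_value''}"
  "writes select_com = {''i'', ''taken'', ''result_cand'', ''result_value''}"
  by (auto simp: taken_com_def argmax_com_def select_com_def)

lemma writes_threshold_com:
  "writes threshold_com = {''h'', ''i'', ''factor'', ''slack'', ''prescore'', ''value'', ''taken'',
     ''result_cand'', ''result_value''}"
  unfolding threshold_com_def by (auto simp: writes_select_com writes_prescores_com)

context solution
begin

lemma taken_com:
  assumes st: "stores \<sigma> I A w vs cs es sel"
  shows "runs (length es) taken_com \<sigma> (\<lambda>\<sigma>'. \<forall>c<length cs.
    iarr \<sigma>' ''taken'' c = (if cs ! c \<in> A then 1 else 0))"
  unfolding taken_com_def
proof (rule runs_SeqI[where S = "\<lambda>\<sigma>'. \<forall>c<length cs. iarr \<sigma>' ''taken'' c = 0"], goal_cases)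
  case 1
  show ?case
    by (rule runs_ForI[where Inv = "\<lambda>j \<sigma>'. \<forall>c<j. iarr \<sigma>' ''taken'' c = 0" and N = "length cs" and X = "{''taken''}"])
       (use storesD[OF st] stores_bounds[OF st] in \<open>auto simp: less_Suc_eq intro!: runs_intros\<close>)
next
  case (2 \<sigma>1)
  then have a: "agree {''i'', ''taken''} \<sigma> \<sigma>1" by simp
  have st1: "stores \<sigma>1 I A w vs cs es sel" using stores_agree[OF st a] by (simp add: inputs_def)
  note s = storesD[OF st1] and b = stores_bounds[OF st1]
  define Inv :: "nat \<Rightarrow> state \<Rightarrow> bool" where "Inv j \<sigma>' \<longleftrightarrow> (\<forall>c<length cs. iarr \<sigma>' ''taken'' c =
    (if cs ! c \<in> set (take j sel) then 1 else 0))" for j \<sigma>'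
  show ?case
  proof (rule runs_ForI[where Inv = Inv and N = "length sel" and X = "{''taken''}"], goal_cases)
    case (1 j \<sigma>')
    have st': "stores \<sigma>' I A w vs cs es sel" using stores_agree[OF st1 1(3)] by (simp add: inputs_def)
    note s' = storesD[OF st']
    have eq: "c = iarr \<sigma>' ''selected'' j \<longleftrightarrow> cs ! c = sel ! j" if "c < length cs" for c
      using s'(19,20)[OF 1(1)] s'(3) that by (metis nth_eq_iff_index_eq)
    show ?case
      using 1(1,2,4) eq
      by (auto simp: Inv_def take_Suc_conv_app_nth intro!: runs_intros)
  qed (use s b 2 in \<open>auto simp: Inv_def\<close>)
qed

definition argmax_at :: "state \<Rightarrow> 'c list \<Rightarrow> ('c \<Rightarrow> real) \<Rightarrow> 'c \<Rightarrow> bool" where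
  "argmax_at \<sigma> cs f c \<longleftrightarrow> c \<in> cands I - A \<and> returns \<sigma> cs c (f c) \<and> (\<forall>c'\<in>cands I - A. f c' \<le> f c)"

lemma argmax_com:
  assumes st: "stores \<sigma> I A w vs cs es sel"
    and v: "\<forall>c<length cs. rarr \<sigma> ''value'' c = f (cs ! c)"
    and t: "\<forall>c<length cs. iarr \<sigma> ''taken'' c = (if cs ! c \<in> A then 1 else 0)"
  shows "runs (length es) argmax_com \<sigma> (\<lambda>\<sigma>'. \<exists>c. argmax_at \<sigma>' cs f c)"
  unfolding argmax_com_def
proof (rule runs_SeqI[where S = "\<lambda>\<sigma>'. ivar \<sigma>' ''result_cand'' = length cs"], goal_cases)
  case 1
  show ?case using storesD[OF st] stores_bounds[OF st] by (intro runs_intros) auto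
next
  case (2 \<sigma>1)
  then have a: "agree {''result_cand''} \<sigma> \<sigma>1" by simp
  have st1: "stores \<sigma>1 I A w vs cs es sel" using stores_agree[OF st a] by (simp add: inputs_def)
  note s = storesD[OF st1] and b = stores_bounds[OF st1]
  \<comment> \<open>While the sentinel is in place the first clause is vacuous; the second says that
    it disappears with the first unselected candidate met.\<close>
  define Inv :: "nat \<Rightarrow> state \<Rightarrow> bool" where "Inv j \<sigma>' \<longleftrightarrow>
    (ivar \<sigma>' ''result_cand'' < length cs \<longrightarrow> cs ! ivar \<sigma>' ''result_cand'' \<notin> A \<and>
      rvar \<sigma>' ''result_value'' = f (cs ! ivar \<sigma>' ''result_cand'')) \<and>
    (\<forall>c<j. cs ! c \<notin> A \<longrightarrow> ivar \<sigma>' ''result_cand'' < length cs \<and> f (cs ! c) \<le> rvar \<sigma>' ''result_value'')"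
    for j \<sigma>'
  show ?case
  proof (rule runs_ForI[where Inv = Inv and N = "length cs" and X = "{''result_cand'', ''result_value''}"],
      goal_cases)
    case (1 j \<sigma>')
    have st': "stores \<sigma>' I A w vs cs es sel" using stores_agree[OF st1 1(3)] by (simp add: inputs_def)
    note s' = storesD[OF st']
    have "rarr \<sigma>' ''value'' j = f (cs ! j)" "iarr \<sigma>' ''taken'' j = (if cs ! j \<in> A then 1 else 0)"
      using agreeD[OF 1(3)] agreeD[OF a] v t 1(1) by auto
    then show ?case
      using 1(1,2,4) s'(10)
      by (intro runs_intros) (auto simp: Inv_def less_Suc_eq split: if_splits)
  next
    case (3 \<sigma>')
    \<comment> \<open>Some candidate is unselected, since there are fewer seats than candidates;
      hence the sentinel has been replaced.\<close>
    obtain c0 where "c0 \<in> cands I - A" using unselected_nonempty by blast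
    then obtain j where "j < length cs" "cs ! j = c0" using s(4) by (metis DiffD1 in_set_conv_nth)
    with 3(1) \<open>c0 \<in> cands I - A\<close> have r: "ivar \<sigma>' ''result_cand'' < length cs" by (auto simp: Inv_def)
    let ?c = "cs ! ivar \<sigma>' ''result_cand''"
    have "?c \<in> cands I" using r s(4) nth_mem by blast
    moreover have "f c' \<le> f ?c" if "c' \<in> cands I - A" for c'
    proof -
      obtain j where "j < length cs" "cs ! j = c'" using s(4) \<open>c' \<in> _\<close> by (metis DiffD1 in_set_conv_nth)
      then show ?thesis using 3(1) r that by (auto simp: Inv_def)
    qed
    ultimately have "argmax_at \<sigma>' cs f ?c"
      using 3(1) r by (auto simp: argmax_at_def returns_def Inv_def)
    then show ?case by blast
  qed (use s b 2 in \<open>auto simp: Inv_def\<close>)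
qed

lemma select_com:
  assumes st: "stores \<sigma> I A w vs cs es sel"
    and v: "\<forall>c<length cs. rarr \<sigma> ''value'' c = f (cs ! c)"
  shows "runs (length es) select_com \<sigma> (\<lambda>\<sigma>'. \<exists>c. argmax_at \<sigma>' cs f c)"
  unfolding select_com_def
proof (rule runs_SeqI[OF taken_com[OF st]])
  fix \<sigma>1 assume 1: "\<forall>c<length cs. iarr \<sigma>1 ''taken'' c = (if cs ! c \<in> A then 1 else 0)"
    "agree (writes taken_com) \<sigma> \<sigma>1"
  have "stores \<sigma>1 I A w vs cs es sel"
    using stores_agree[OF st 1(2)] by (simp add: inputs_def writes_select_com)
  then show "runs (length es) argmax_com \<sigma>1 (\<lambda>\<sigma>'. \<exists>c. argmax_at \<sigma>' cs f c)"
    using 1 v agreeD[OF 1(2)] by (intro argmax_com) (auto simp: writes_select_com)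
qed

lemma threshold_com:
  assumes st: "stores \<sigma> I A w vs cs es sel" and t: "rvar \<sigma> ''t'' = t" "0 \<le> t"
  shows "runs (length es) threshold_com \<sigma> (\<lambda>\<sigma>'. \<exists>c. argmax_at \<sigma>' cs (\<lambda>c. prescore I A w c t) c)"
  unfolding threshold_com_def
proof (rule runs_SeqI[where S = "\<lambda>\<sigma>'. rvar \<sigma>' ''h'' = t"], goal_cases)
  case 1
  show ?case using t stores_bounds[OF st] by (intro runs_intros) auto
next
  case (2 \<sigma>1)
  then have a: "agree {''h''} \<sigma> \<sigma>1" by simp
  have st1: "stores \<sigma>1 I A w vs cs es sel" using stores_agree[OF st a] by (simp add: inputs_def)
  have t1: "rvar \<sigma>1 ''t'' = t" using agreeD[OF a] t by simp
  show ?case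
  proof (rule runs_SeqI[OF prescores_com[OF st1]], goal_cases)
    case (1 \<sigma>2)
    have st2: "stores \<sigma>2 I A w vs cs es sel"
      using stores_agree[OF st1 1(2)] by (simp add: inputs_def writes_prescores_com)
    have p: "\<forall>c<length cs. rarr \<sigma>2 ''prescore'' c = prescore I A w (cs ! c) t"
      using 1(1) 2(1) t1 t(2) by (auto intro!: affine_prescore_eq_prescore)
    show ?case
    proof (rule runs_SeqI[where S = "\<lambda>\<sigma>'. \<forall>c<length cs. rarr \<sigma>' ''value'' c = prescore I A w (cs ! c) t"],
        goal_cases)
      case 1
      then show ?case
        using storesD[OF st2] stores_bounds[OF st2] p by (intro runs_For_RStore) (auto simp: agree_def)
    next
      case (2 \<sigma>3)
      then have "stores \<sigma>3 I A w vs cs es sel"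
        using stores_agree[OF st2 2(2)] by (simp add: inputs_def)
      then show ?case using 2(1) by (rule select_com)
    qed
  qed
qed

end

section \<open>Sorting the supports\<close>

text \<open>The runs are the aligned blocks on which \<open>x div W\<close> is constant. At
  \<open>W = 1\<close> the property is trivial, and for \<open>W \<ge> m\<close> it is sortedness of
  the first \<open>m\<close> entries.\<close>

definition sorted_runs :: "nat \<Rightarrow> nat \<Rightarrow> (nat \<Rightarrow> real) \<Rightarrow> bool" where
  "sorted_runs W m b \<longleftrightarrow> (\<forall>x y. x \<le> y \<longrightarrow> y < m \<longrightarrow> x div W = y div W \<longrightarrow> b x \<le> b y)"

text \<open>The first \<open>i\<close> entries of \<open>b'\<close> have been written, the last of them by merging the runs
  \<open>{nxt - 2 * W..<mid}\<close> and \<open>{mid..<nxt}\<close> of \<open>b\<close>, of which \<open>{l..<mid}\<close> and \<open>{r..<nxt}\<close> remain.\<close>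

definition merging ::
  "nat \<Rightarrow> nat \<Rightarrow> (nat \<Rightarrow> real) \<Rightarrow> (nat \<Rightarrow> real) \<Rightarrow> nat \<Rightarrow> nat \<Rightarrow> nat \<Rightarrow> nat \<Rightarrow> nat \<Rightarrow> bool" where
  "merging W m b b' i l mid r nxt \<longleftrightarrow>
     (\<exists>p. mid = p * (2 * W) + W \<and> nxt = mid + W \<and> p * (2 * W) \<le> l \<and> l \<le> mid \<and> mid \<le> r \<and> r \<le> nxt \<and>
       (r = mid \<or> r \<le> m) \<and> i + mid = l + r \<and>
       (\<forall>x. p * (2 * W) \<le> x \<longrightarrow> x < i \<longrightarrow>
         (l < mid \<longrightarrow> l < m \<longrightarrow> b' x \<le> b l) \<and> (r < nxt \<longrightarrow> r < m \<longrightarrow> b' x \<le> b r))) \<and>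
     b' ` {..<i} = b ` ({..<l} \<union> {mid..<r})"

lemma div_eq_of_block: "p * W \<le> x \<Longrightarrow> x < p * W + W \<Longrightarrow> x div W = (p::nat)"
  by (metis add.commute div_nat_eqI mult.commute mult_Suc_right)

lemma merging_start:
  assumes "2 * W dvd i" "b' ` {..<i} = b ` {..<i}" "0 < W"
  shows "merging W m b b' i i (i + W) (i + W) (i + W + W)"
proof -
  from assms(1) obtain p where "i = p * (2 * W)" by (metis dvd_div_mult_self)
  then show ?thesis using assms by (auto simp: merging_def intro!: exI[of _ p])
qed

lemma merging_finish:
  assumes "merging W m b b' nxt l mid r nxt"
  shows "2 * W dvd nxt" "b' ` {..<nxt} = b ` {..<nxt}"
proof -
  obtain p where p: "mid = p * (2 * W) + W" "nxt = mid + W" "l \<le> mid" "mid \<le> r" "r \<le> nxt" "nxt + mid = l + r"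
    using assms unfolding merging_def by blast
  then have "nxt = (2 * W) * (p + 1)" by (simp add: algebra_simps)
  then show "2 * W dvd nxt" by simp
  have "l = mid" "r = nxt" using p(2-6) by linarith+
  then have "{..<l} \<union> {mid..<r} = {..<nxt}" using p(2) by auto
  then show "b' ` {..<nxt} = b ` {..<nxt}" using assms unfolding merging_def by simp
qed

text \<open>The array may end inside a pair of runs. The clause \<open>r = mid\<close> or
  \<open>r \<le> m\<close> leaves two cases: the right run is untouched and \<open>l = m\<close>, or
  the left run is exhausted and \<open>r = m\<close>.\<close>

lemma merging_end:
  assumes "merging W m b b' m l mid r nxt"
  shows "b' ` {..<m} = b ` {..<m}"
proof -
  obtain p where p: "l \<le> mid" "mid \<le> r" "r = mid \<or> r \<le> m" "m + mid = l + r"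
    using assms unfolding merging_def by blast
  have "{..<l} \<union> {mid..<r} = {..<m}" using p by auto
  then show ?thesis using assms unfolding merging_def by simp
qed

text \<open>All entries written for the current pair are at most both heads. Writing the smaller
  head keeps this true: the next left entry is no smaller since its run is sorted, the right head by
  comparison.\<close>

lemma merging_left:
  assumes inv: "merging W m b b' i l mid r nxt" and runs: "sorted_runs W m b"
    and sorted: "sorted_runs (2 * W) i b'" and "i < m"
    and left: "l < mid" "\<not> (r < nxt \<and> r < m \<and> b r < b l)"
  shows "merging W m b (b'(i := b l)) (Suc i) (Suc l) mid r nxt"
    "sorted_runs (2 * W) (Suc i) (b'(i := b l))"
proof -
  obtain p where p: "mid = p * (2 * W) + W" "nxt = mid + W" "p * (2 * W) \<le> l" "l \<le> mid" "mid \<le> r" "r \<le> nxt"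
      "r = mid \<or> r \<le> m" "i + mid = l + r"
    and le: "\<And>x. p * (2 * W) \<le> x \<Longrightarrow> x < i \<Longrightarrow> l < mid \<Longrightarrow> l < m \<Longrightarrow> b' x \<le> b l"
      "\<And>x. p * (2 * W) \<le> x \<Longrightarrow> x < i \<Longrightarrow> r < nxt \<Longrightarrow> r < m \<Longrightarrow> b' x \<le> b r"
    and img: "b' ` {..<i} = b ` ({..<l} \<union> {mid..<r})"
    using inv unfolding merging_def by blast
  \<comment> \<open>\<open>i + mid = l + r\<close> and \<open>mid \<le> r\<close> give
    \<open>l \<le> i\<close>. This is why the program compares only the right head with the length
    of the array.\<close>
  have lm: "l < m" using p \<open>i < m\<close> by simp
  have step: "b l \<le> b (Suc l)" if "Suc l < mid" "Suc l < m"
  proof -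
    \<comment> \<open>Pair \<open>p\<close> of width \<open>2 * W\<close> consists of the blocks
      \<open>2 * p\<close> and \<open>2 * p + 1\<close> of width \<open>W\<close>.\<close>
    have "l div W = 2 * p" "Suc l div W = 2 * p"
      using p(1,3) that by (auto intro!: div_eq_of_block simp: algebra_simps)
    then show ?thesis using runs that unfolding sorted_runs_def by auto
  qed
  have "(b'(i := b l)) ` {..<Suc i} = insert (b l) (b' ` {..<i})"
    by (auto simp: lessThan_Suc image_iff)
  also have "\<dots> = b ` ({..<Suc l} \<union> {mid..<r})"
    unfolding img by (auto simp: lessThan_Suc)
  finally have img': "(b'(i := b l)) ` {..<Suc i} = b ` ({..<Suc l} \<union> {mid..<r})" .
  have "(Suc l < mid \<longrightarrow> Suc l < m \<longrightarrow> (b'(i := b l)) x \<le> b (Suc l)) \<and>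
      (r < nxt \<longrightarrow> r < m \<longrightarrow> (b'(i := b l)) x \<le> b r)"
    if "p * (2 * W) \<le> x" "x < Suc i" for x
    using le[OF that(1)] that(2) left step lm by (cases "x = i") force+
  then show "merging W m b (b'(i := b l)) (Suc i) (Suc l) mid r nxt"
    unfolding merging_def using img' p left by (intro conjI exI[of _ p]) auto
  have i: "i div (2 * W) = p" using p left by (intro div_eq_of_block) auto
  have "b' x \<le> b l" if "x < i" "x div (2 * W) = p" for x
  proof -
    have "p * (2 * W) \<le> x" using that(2) by auto
    then show ?thesis using le(1) that left lm by blast
  qed
  then show "sorted_runs (2 * W) (Suc i) (b'(i := b l))"
    using sorted i unfolding sorted_runs_def by (auto simp: less_Suc_eq)
qed

lemma merging_right:
  assumes inv: "merging W m b b' i l mid r nxt" and runs: "sorted_runs W m b"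
    and sorted: "sorted_runs (2 * W) i b'" and "i < m" "i < nxt"
    and right: "\<not> (l < mid \<and> \<not> (r < nxt \<and> r < m \<and> b r < b l))"
  shows "merging W m b (b'(i := b r)) (Suc i) l mid (Suc r) nxt"
    "sorted_runs (2 * W) (Suc i) (b'(i := b r))"
proof -
  obtain p where p: "mid = p * (2 * W) + W" "nxt = mid + W" "p * (2 * W) \<le> l" "l \<le> mid" "mid \<le> r" "r \<le> nxt"
      "r = mid \<or> r \<le> m" "i + mid = l + r"
    and le: "\<And>x. p * (2 * W) \<le> x \<Longrightarrow> x < i \<Longrightarrow> l < mid \<Longrightarrow> l < m \<Longrightarrow> b' x \<le> b l"
      "\<And>x. p * (2 * W) \<le> x \<Longrightarrow> x < i \<Longrightarrow> r < nxt \<Longrightarrow> r < m \<Longrightarrow> b' x \<le> b r"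
    and img: "b' ` {..<i} = b ` ({..<l} \<union> {mid..<r})"
    using inv unfolding merging_def by blast
  \<comment> \<open>If the left run is exhausted then \<open>i = r\<close>, and the bounds on
    \<open>i\<close> carry over; otherwise the failed test supplies them.\<close>
  have r: "r < nxt" "r < m" "l < mid \<Longrightarrow> b r < b l"
    using p right \<open>i < m\<close> \<open>i < nxt\<close> by (cases "l < mid"; simp)+
  have step: "b r \<le> b (Suc r)" if "Suc r < nxt" "Suc r < m"
  proof -
    have "r div W = 2 * p + 1" "Suc r div W = 2 * p + 1"
      using p(1,2,5) that by (auto intro!: div_eq_of_block simp: algebra_simps)
    then show ?thesis using runs that unfolding sorted_runs_def by auto
  qed
  have "(b'(i := b r)) ` {..<Suc i} = insert (b r) (b' ` {..<i})"
    by (auto simp: lessThan_Suc image_iff)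
  also have "\<dots> = b ` ({..<l} \<union> {mid..<Suc r})"
    unfolding img using p(5) by (auto simp: atLeastLessThanSuc)
  finally have img': "(b'(i := b r)) ` {..<Suc i} = b ` ({..<l} \<union> {mid..<Suc r})" .
  have "(l < mid \<longrightarrow> l < m \<longrightarrow> (b'(i := b r)) x \<le> b l) \<and>
      (Suc r < nxt \<longrightarrow> Suc r < m \<longrightarrow> (b'(i := b r)) x \<le> b (Suc r))"
    if "p * (2 * W) \<le> x" "x < Suc i" for x
    using le[OF that(1)] that(2) r step by (cases "x = i") force+
  then show "merging W m b (b'(i := b r)) (Suc i) l mid (Suc r) nxt"
    unfolding merging_def using img' p r by (intro conjI exI[of _ p]) auto
  have i: "i div (2 * W) = p" using p \<open>i < nxt\<close> by (intro div_eq_of_block) auto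
  have "b' x \<le> b r" if "x < i" "x div (2 * W) = p" for x
  proof -
    have "p * (2 * W) \<le> x" using that(2) by auto
    then show ?thesis using le(2) that r by blast
  qed
  then show "sorted_runs (2 * W) (Suc i) (b'(i := b r))"
    using sorted i unfolding sorted_runs_def by (auto simp: less_Suc_eq)
qed

text \<open>Nested loops over pairs and their entries are flattened: each step writes one entry and
  opens a new pair if \<open>i\<close> has reached \<open>next\<close>. A step takes constant time,
  so a pass is linear whatever the width.\<close>

definition merge_step_com :: com where
  "merge_step_com = Seq
     (Cond (ILess (IVar ''i'') (IVar ''next'')) Skip
       (Seq (ISet ''left'' (IVar ''i''))
       (Seq (ISet ''mid'' (IAdd (IVar ''i'') (IVar ''width'')))
       (Seq (ISet ''right'' (IVar ''mid''))
            (ISet ''next'' (IAdd (IVar ''mid'') (IVar ''width'')))))))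
     (Cond (BAnd (ILess (IVar ''left'') (IVar ''mid''))
         (BNot (BAnd (BAnd (ILess (IVar ''right'') (IVar ''next'')) (ILess (IVar ''right'') (IVar ''num_selected'')))
           (RLess (RArr ''sorted'' (IVar ''right'')) (RArr ''sorted'' (IVar ''left''))))))
       (Seq (RStore ''merged'' (IVar ''i'') (RArr ''sorted'' (IVar ''left'')))
            (ISet ''left'' (IAdd (IVar ''left'') (INum 1))))
       (Seq (RStore ''merged'' (IVar ''i'') (RArr ''sorted'' (IVar ''right'')))
            (ISet ''right'' (IAdd (IVar ''right'') (INum 1)))))"

definition merge_pass_com :: com where
  "merge_pass_com = Seq (ISet ''next'' (INum 0)) (For ''i'' ''num_selected'' merge_step_com)"

text \<open>Merge sort is done bottom-up, doubling \<open>width\<close>, because the language has no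
  recursion. Copying back lets each pass read from \<open>sorted\<close>.\<close>

definition sort_com :: com where
  "sort_com =
     Seq (For ''i'' ''num_selected'' (RStore ''sorted'' (IVar ''i'') (RArr ''supp'' (IVar ''i''))))
     (Seq (ISet ''width'' (INum 1))
     (While (ILess (IVar ''width'') (IVar ''num_selected''))
       (Seq merge_pass_com
       (Seq (For ''i'' ''num_selected'' (RStore ''sorted'' (IVar ''i'') (RArr ''merged'' (IVar ''i''))))
         (ISet ''width'' (IAdd (IVar ''width'') (IVar ''width'')))))))"

lemma writes_merge_step_com: "writes merge_step_com = {''left'', ''mid'', ''right'', ''next'', ''merged''}"
  by (auto simp: merge_step_com_def)

lemma writes_merge_pass_com:
  "writes merge_pass_com = {''i'', ''left'', ''mid'', ''right'', ''next'', ''merged''}"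
  by (auto simp: merge_pass_com_def writes_merge_step_com)

lemma writes_sort_com:
  "writes sort_com = {''i'', ''left'', ''mid'', ''right'', ''next'', ''merged'', ''sorted'', ''width''}"
  by (auto simp: sort_com_def writes_merge_pass_com)

text \<open>The first disjunct describes the boundary between pairs, where \<open>left\<close>,
  \<open>mid\<close> and \<open>right\<close> are stale or not yet set; the second describes an open
  pair.\<close>

definition merge_inv :: "nat \<Rightarrow> nat \<Rightarrow> (nat \<Rightarrow> real) \<Rightarrow> nat \<Rightarrow> state \<Rightarrow> bool" where
  "merge_inv W m b i \<sigma> \<longleftrightarrow> sorted_runs (2 * W) i (rarr \<sigma> ''merged'') \<and>
     (ivar \<sigma> ''next'' = i \<and> 2 * W dvd i \<and> rarr \<sigma> ''merged'' ` {..<i} = b ` {..<i} \<or>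
      i < ivar \<sigma> ''next'' \<and> merging W m b (rarr \<sigma> ''merged'') i
        (ivar \<sigma> ''left'') (ivar \<sigma> ''mid'') (ivar \<sigma> ''right'') (ivar \<sigma> ''next''))"

lemma merge_step_com:
  assumes inv: "merge_inv W m (rarr \<sigma> ''sorted'') i \<sigma>" and "sorted_runs W m (rarr \<sigma> ''sorted'')"
    "i < m" "0 < W" "ivar \<sigma> ''i'' = i" "ivar \<sigma> ''num_selected'' = m" "ivar \<sigma> ''width'' = W"
  shows "runs 1 merge_step_com \<sigma> (merge_inv W m (rarr \<sigma> ''sorted'') (Suc i))"
  unfolding merge_step_com_def
proof (rule runs_SeqI[where S = "\<lambda>\<sigma>'. rarr \<sigma>' = rarr \<sigma> \<and> i < ivar \<sigma>' ''next'' \<and>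
    merging W m (rarr \<sigma> ''sorted'') (rarr \<sigma> ''merged'') i
        (ivar \<sigma>' ''left'') (ivar \<sigma>' ''mid'') (ivar \<sigma>' ''right'') (ivar \<sigma>' ''next'')"], goal_cases)
  case 1
  then show ?case
    using assms merging_start[of W i "rarr \<sigma> ''merged''" "rarr \<sigma> ''sorted''" m]
    by (intro runs_intros) (auto simp: merge_inv_def)
next
  case (2 \<sigma>')
  let ?b = "rarr \<sigma> ''sorted''" and ?b' = "rarr \<sigma> ''merged''"
  let ?l = "ivar \<sigma>' ''left''" and ?mid = "ivar \<sigma>' ''mid''" and ?r = "ivar \<sigma>' ''right''"
  let ?nxt = "ivar \<sigma>' ''next''"
  have fr: "ivar \<sigma>' ''i'' = i" "ivar \<sigma>' ''num_selected'' = m"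
    using agreeD[OF 2(2)] assms by auto
  have s: "sorted_runs (2 * W) i ?b'" using inv by (simp add: merge_inv_def)
  \<comment> \<open>Writing the last entry of a pair closes it and returns to the first
    disjunct.\<close>
  have advance: "merge_inv W m ?b (Suc i) \<sigma>''"
    if "merging W m ?b (rarr \<sigma>'' ''merged'') (Suc i)
        (ivar \<sigma>'' ''left'') (ivar \<sigma>'' ''mid'') (ivar \<sigma>'' ''right'') ?nxt" "ivar \<sigma>'' ''next'' = ?nxt"
      "sorted_runs (2 * W) (Suc i) (rarr \<sigma>'' ''merged'')" for \<sigma>''
  proof (cases "Suc i = ?nxt")
    case True
    then show ?thesis using that merging_finish[of W m ?b "rarr \<sigma>'' ''merged''" "Suc i"]
      by (simp add: merge_inv_def)
  next
    case False
    then show ?thesis using that 2(1) by (simp add: merge_inv_def)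
  qed
  show ?case
  proof (rule runs_Cond, goal_cases)
    case 2
    then have c: "?l < ?mid" "\<not> (?r < ?nxt \<and> ?r < m \<and> ?b ?r < ?b ?l)"
      using fr \<open>rarr \<sigma>' = rarr \<sigma> \<and> _\<close> by auto
    note * = merging_left[OF _ assms(2) s assms(3) c]
    show ?case using * \<open>rarr \<sigma>' = rarr \<sigma> \<and> _\<close> fr by (intro runs_intros advance) auto
  next
    case 3
    then have c: "\<not> (?l < ?mid \<and> \<not> (?r < ?nxt \<and> ?r < m \<and> ?b ?r < ?b ?l))"
      using fr \<open>rarr \<sigma>' = rarr \<sigma> \<and> _\<close> by auto
    note * = merging_right[OF _ assms(2) s assms(3) _ c]
    show ?case using * \<open>rarr \<sigma>' = rarr \<sigma> \<and> _\<close> fr by (intro runs_intros advance) auto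
  qed simp
qed

lemma merge_pass_com:
  assumes "sorted_runs W m (rarr \<sigma> ''sorted'')" "0 < W" "ivar \<sigma> ''num_selected'' = m" "ivar \<sigma> ''width'' = W"
    "m \<le> E" "1 \<le> E"
  shows "runs E merge_pass_com \<sigma> (\<lambda>\<sigma>'. sorted_runs (2 * W) m (rarr \<sigma>' ''merged'') \<and>
    rarr \<sigma>' ''merged'' ` {..<m} = rarr \<sigma> ''sorted'' ` {..<m})"
  unfolding merge_pass_com_def
proof (rule runs_SeqI[where S = "\<lambda>\<sigma>'. ivar \<sigma>' ''next'' = 0"], goal_cases)
  case 1
  show ?case using assms by (intro runs_intros) auto
next
  case (2 \<sigma>1)
  let ?b = "rarr \<sigma> ''sorted''"
  show ?case
  proof (rule runs_ForI[where Inv = "merge_inv W m ?b" and N = m and X = "writes merge_step_com"], goal_cases)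
    case (1 j \<sigma>')
    have "rarr \<sigma>' ''sorted'' = ?b" "ivar \<sigma>' ''num_selected'' = m" "ivar \<sigma>' ''width'' = W"
      using agreeD[OF 1(3)] agreeD[OF 2(2)] assms(3,4) by (auto simp: writes_merge_step_com)
    then show ?case using merge_step_com[of W m \<sigma>' j] 1 assms by simp
  next
    case (3 \<sigma>')
    then show ?case by (auto simp: merge_inv_def dest: merging_end)
  qed (use 2 assms agreeD[OF 2(2)] in \<open>auto simp: merge_inv_def writes_merge_step_com sorted_runs_def\<close>)
qed

text \<open>Only the set of values is tracked, not multiplicities: the search merely needs every
  support to occur among the sorted entries and vice versa. After \<open>p\<close> passes the width
  is \<open>2 ^ p\<close>, so \<open>L\<close> passes suffice.\<close>

lemma sort_com:
  assumes "ivar \<sigma> ''num_selected'' = m" "m \<le> E" "1 \<le> E" "m \<le> 2 ^ L" "1 \<le> L"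
  shows "runs (E * L) sort_com \<sigma> (\<lambda>\<sigma>'. sorted_runs m m (rarr \<sigma>' ''sorted'') \<and>
    rarr \<sigma>' ''sorted'' ` {..<m} = rarr \<sigma> ''supp'' ` {..<m})"
proof -
  have E: "1 \<le> E * L" "m \<le> E * L"
    using assms(2,3,5) mult_le_mono[of 1 E 1 L] mult_le_mono[of m E 1 L] by simp_all
  define b where "b = rarr \<sigma> ''supp''"
  define Inv where "Inv v \<sigma>' \<longleftrightarrow> ivar \<sigma>' ''num_selected'' = m \<and> (\<exists>p. v + p = L \<and> ivar \<sigma>' ''width'' = 2 ^ p) \<and>
    sorted_runs (ivar \<sigma>' ''width'') m (rarr \<sigma>' ''sorted'') \<and> rarr \<sigma>' ''sorted'' ` {..<m} = b ` {..<m}"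
    for v and \<sigma>' :: state
  show ?thesis
    unfolding sort_com_def
  proof (rule runs_SeqI[where S = "\<lambda>\<sigma>'. \<forall>j<m. rarr \<sigma>' ''sorted'' j = b j"], goal_cases)
    case 1
    show ?case using assms E by (intro runs_For_RStore) (simp_all add: agree_def b_def)
  next
    case (2 \<sigma>1)
    have img: "rarr \<sigma>1 ''sorted'' ` {..<m} = b ` {..<m}" using 2(1) by (auto intro!: image_cong)
    have m1: "ivar \<sigma>1 ''num_selected'' = m" using agreeD[OF 2(2)] assms(1) by simp
    show ?case
    proof (rule runs_SeqI[where S = "Inv L"], goal_cases)
      case 1
      show ?case using E img m1 by (intro runs_intros) (auto simp: Inv_def sorted_runs_def)
    next
      case (2 \<sigma>2)
      show ?case
      proof (rule runs_conseq[OF runs_While[where Inv = Inv and v = L] order_refl], goal_cases)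
        case (1 v \<sigma>')
        then obtain p where p: "v + p = L" "ivar \<sigma>' ''width'' = 2 ^ p" and w: "ivar \<sigma>' ''width'' < m"
          and m: "ivar \<sigma>' ''num_selected'' = m" and s: "sorted_runs (ivar \<sigma>' ''width'') m (rarr \<sigma>' ''sorted'')"
          and i: "rarr \<sigma>' ''sorted'' ` {..<m} = b ` {..<m}"
          by (auto simp: Inv_def)
        have "(2::nat) ^ p < 2 ^ L" using w p(2) assms(4) by linarith
        then have "p < L" by simp
        then obtain u where u: "v = Suc u" "u + Suc p = L" using p(1) by (cases v) auto
        let ?W = "2 ^ p :: nat"
        have "runs E (Seq merge_pass_com
           (Seq (For ''i'' ''num_selected'' (RStore ''sorted'' (IVar ''i'') (RArr ''merged'' (IVar ''i''))))
           (ISet ''width'' (IAdd (IVar ''width'') (IVar ''width''))))) \<sigma>' (Inv u)"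
        proof (rule runs_SeqI[OF merge_pass_com[of ?W m]], goal_cases)
          case (7 \<sigma>3)
          have m3: "ivar \<sigma>3 ''num_selected'' = m" and w3: "ivar \<sigma>3 ''width'' = ?W"
            using agreeD[OF 7(2)] m p(2) by (auto simp: writes_merge_pass_com)
          show ?case
          proof (rule runs_SeqI[where S = "\<lambda>\<sigma>'. \<forall>j<m. rarr \<sigma>' ''sorted'' j = rarr \<sigma>3 ''merged'' j"], goal_cases)
            case 1
            show ?case using m3 assms by (intro runs_For_RStore) (auto simp: agree_def)
          next
            case (2 \<sigma>4)
            have img4: "rarr \<sigma>4 ''sorted'' ` {..<m} = rarr \<sigma>3 ''merged'' ` {..<m}"
              using 2(1) by (auto intro!: image_cong)
            have s4: "sorted_runs (2 * ?W) m (rarr \<sigma>4 ''sorted'')"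
              using 2(1) 7(1) by (auto simp: sorted_runs_def)
            have e4: "\<exists>q. u + q = L \<and> ?W + ?W = 2 ^ q"
              using u(2) by (intro exI[of _ "Suc p"]) simp
            have mw4: "ivar \<sigma>4 ''num_selected'' = m" "ivar \<sigma>4 ''width'' = ?W"
              using agreeD[OF 2(2)] m3 w3 by auto
            show ?case
            proof (rule runs_ISet)
              show "Inv u (\<sigma>4\<lparr>ivar := (ivar \<sigma>4)(''width'' := ival (IAdd (IVar ''width'') (IVar ''width'')) \<sigma>4)\<rparr>)"
                using s4 e4 mw4 img4 7(1) i by (simp add: Inv_def mult_2)
            qed (fact assms(3))
          qed
        qed (use m p s assms in auto)
        with u show ?case by blast
      next
        case (6 \<sigma>')
        then obtain u where w: "\<not> ivar \<sigma>' ''width'' < m" and inv: "Inv u \<sigma>'" by (auto simp: Inv_def)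
        \<comment> \<open>Once the width is at least \<open>m\<close>, all indices below
          \<open>m\<close> lie in block 0.\<close>
        have "sorted_runs m m (rarr \<sigma>' ''sorted'')"
          using inv w unfolding Inv_def sorted_runs_def by auto
        then show ?case using inv by (auto simp: Inv_def b_def)
      qed (use 2 assms in auto)
    qed
  qed
qed

section \<open>Computing the maximum score\<close>

definition search_step_com :: com where
  "search_step_com =
     Seq (ISet ''pivot'' (IHalf (IAdd (IVar ''first'') (IVar ''last''))))
     (Seq (RSet ''t'' (RArr ''sorted'' (IVar ''pivot'')))
     (Seq threshold_com
       (Cond (RLess (RVar ''result_value'') (RVar ''t''))
         (ISet ''last'' (IVar ''pivot''))
         (Seq (ISet ''first'' (IAdd (IVar ''pivot'') (INum 1))) (RSet ''low'' (RVar ''t''))))))"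

definition search_com :: com where
  "search_com =
     Seq (Seq (ISet ''first'' (INum 0)) (Seq (ISet ''last'' (IVar ''num_selected'')) (RSet ''low'' (RNum 0))))
     (While (ILess (IVar ''first'') (IVar ''last'')) search_step_com)"

text \<open>The values at 0 are parked in \<open>value\<close>, which \<open>prescores_com\<close>
  does not write, while the second evaluation overwrites \<open>prescore\<close>.\<close>

definition solve_com :: com where
  "solve_com =
     Seq (Seq (RSet ''h'' (RVar ''low'')) (RSet ''t'' (RNum 0)))
     (Seq prescores_com
     (Seq (For ''i'' ''num_cands'' (RStore ''value'' (IVar ''i'') (RArr ''prescore'' (IVar ''i''))))
     (Seq (RSet ''t'' (RNum 1))
     (Seq prescores_com
     (Seq (For ''i'' ''num_cands'' (RStore ''value'' (IVar ''i'') (RDiv (RArr ''value'' (IVar ''i''))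
         (RAdd (RNum 1) (RSub (RArr ''value'' (IVar ''i'')) (RArr ''prescore'' (IVar ''i'')))))))
       select_com)))))"

definition score_com :: com where
  "score_com = Seq sort_com (Seq search_com solve_com)"

lemma writes_search_com:
  "writes search_com = writes threshold_com \<union> {''pivot'', ''t'', ''first'', ''last'', ''low''}"
  by (auto simp: search_com_def search_step_com_def)

context solution
begin

text \<open>The half-open interval from \<open>first\<close> to \<open>last\<close> holds the
  undecided supports. Earlier ones are at most \<open>low\<close>, which some score reaches; later
  ones exceed the score of every unselected candidate. The strict bound \<open>2 ^ v\<close> forces
  the interval to be empty at \<open>v = 0\<close>.\<close>

definition search_inv :: "(nat \<Rightarrow> real) \<Rightarrow> 'n list \<Rightarrow> 'c list \<Rightarrow> ('n \<times> 'c) list \<Rightarrow> 'c list \<Rightarrow> nat \<Rightarrow> state \<Rightarrow> bool"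
  where
  "search_inv b vs cs es sel v \<sigma> \<longleftrightarrow>
     stores \<sigma> I A w vs cs es sel \<and> rarr \<sigma> ''sorted'' = b \<and>
     ivar \<sigma> ''first'' \<le> ivar \<sigma> ''last'' \<and> ivar \<sigma> ''last'' \<le> length sel \<and>
     ivar \<sigma> ''last'' - ivar \<sigma> ''first'' < 2 ^ v \<and>
     0 \<le> rvar \<sigma> ''low'' \<and> (\<exists>c\<in>cands I - A. rvar \<sigma> ''low'' \<le> prescore I A w c (rvar \<sigma> ''low'')) \<and>
     (\<forall>q<ivar \<sigma> ''first''. b q \<le> rvar \<sigma> ''low'') \<and>
     (\<forall>q<length sel. ivar \<sigma> ''last'' \<le> q \<longrightarrow> (\<forall>c\<in>cands I - A. prescore I A w c (b q) < b q))"

lemma search_step_com: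
  assumes inv: "search_inv b vs cs es sel v \<sigma>" and less: "ivar \<sigma> ''first'' < ivar \<sigma> ''last''"
    and sorted: "\<And>x y. x \<le> y \<Longrightarrow> y < length sel \<Longrightarrow> b x \<le> b y" and nonneg: "\<And>q. q < length sel \<Longrightarrow> 0 \<le> b q"
  shows "\<exists>u. v = Suc u \<and> runs (length es) search_step_com \<sigma> (search_inv b vs cs es sel u)"
proof -
  let ?lo = "ivar \<sigma> ''first''" and ?hi = "ivar \<sigma> ''last''"
  have st: "stores \<sigma> I A w vs cs es sel" and b: "rarr \<sigma> ''sorted'' = b"
    and hi: "?hi \<le> length sel" and size: "?hi - ?lo < 2 ^ v"
    and low: "0 \<le> rvar \<sigma> ''low''" "\<exists>c\<in>cands I - A. rvar \<sigma> ''low'' \<le> prescore I A w c (rvar \<sigma> ''low'')"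
    and below: "\<And>q. q < ?lo \<Longrightarrow> b q \<le> rvar \<sigma> ''low''"
    and above: "\<And>q c. q < length sel \<Longrightarrow> ?hi \<le> q \<Longrightarrow> c \<in> cands I - A \<Longrightarrow> prescore I A w c (b q) < b q"
    using inv unfolding search_inv_def by blast+
  obtain u where u: "v = Suc u" using size less by (cases v) auto
  define p where "p = (?lo + ?hi) div 2"
  have p: "?lo \<le> p" "p < ?hi" "p < length sel" using less hi by (auto simp: p_def)
  \<comment> \<open>An interval of length \<open>d\<close> leaves \<open>d div 2\<close> entries
    before the pivot and at most as many after it, the pivot itself being decided.\<close>
  have size': "p - ?lo < 2 ^ u" "?hi - Suc p < 2 ^ u"
    using size less unfolding u p_def by simp_all
  have E: "1 \<le> length es" using stores_bounds[OF st] by simp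
  have "runs (length es) search_step_com \<sigma> (search_inv b vs cs es sel u)"
    unfolding search_step_com_def
  proof (rule runs_SeqI[where S = "\<lambda>\<sigma>'. ivar \<sigma>' ''pivot'' = p"], goal_cases)
    case 1
    show ?case using E by (intro runs_intros) (auto simp: p_def)
  next
    case (2 \<sigma>1)
    then have a1: "agree {''pivot''} \<sigma> \<sigma>1" by simp
    show ?case
    proof (rule runs_SeqI[where S = "\<lambda>\<sigma>'. rvar \<sigma>' ''t'' = b p"], goal_cases)
      case 1
      show ?case using E 2(1) b agreeD[OF a1] by (intro runs_intros) auto
    next
      case (2 \<sigma>2)
      then have "agree {''t''} \<sigma>1 \<sigma>2" by simp
      from agree_trans[OF a1 this] have a2: "agree {''pivot'', ''t''} \<sigma> \<sigma>2" by (rule agree_mono) auto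
      have piv2: "ivar \<sigma>2 ''pivot'' = p" using agreeD(1)[OF 2(2)] \<open>ivar \<sigma>1 ''pivot'' = p\<close> by simp
      have st2: "stores \<sigma>2 I A w vs cs es sel" using stores_agree[OF st a2] by (simp add: inputs_def)
      show ?case
      proof (rule runs_SeqI[OF threshold_com[OF st2 2(1) nonneg[OF p(3)]]], goal_cases)
        case (1 \<sigma>3)
        then obtain c where c: "c \<in> cands I - A" "rvar \<sigma>3 ''result_value'' = prescore I A w c (b p)"
          "\<And>c'. c' \<in> cands I - A \<Longrightarrow> prescore I A w c' (b p) \<le> prescore I A w c (b p)"
          by (auto simp: argmax_at_def returns_def)
        have st3: "stores \<sigma>3 I A w vs cs es sel"
          using stores_agree[OF st2 1(2)] by (simp add: inputs_def writes_threshold_com)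
        have f3: "ivar \<sigma>3 ''pivot'' = p" "rvar \<sigma>3 ''t'' = b p" "ivar \<sigma>3 ''first'' = ?lo"
          "ivar \<sigma>3 ''last'' = ?hi" "rvar \<sigma>3 ''low'' = rvar \<sigma> ''low''" "rarr \<sigma>3 ''sorted'' = b"
          using agreeD[OF 1(2)] agreeD[OF a2] piv2 2(1) b by (auto simp: writes_threshold_com)
        show ?case
        proof (rule runs_Cond[OF E], goal_cases)
          case 1
          then have lt: "prescore I A w c (b p) < b p" using c(2) f3 by simp
          \<comment> \<open>If even the best prescore at \<open>b p\<close> fails, so do all at
            later entries: the prescore can only fall while the threshold grows.\<close>
          have "prescore I A w c' (b q) < b q" if "q < length sel" "p \<le> q" "c' \<in> cands I - A" for c' q
            using prescore_antimono[OF sorted[OF that(2,1)], of c'] c(3)[OF that(3)] lt sorted[OF that(2,1)]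
            by linarith
          moreover have "stores (\<sigma>3\<lparr>ivar := (ivar \<sigma>3)(''last'' := p)\<rparr>) I A w vs cs es sel"
            by (rule stores_agree[OF st3, of "{''last''}"]) (auto simp: agree_def inputs_def)
          ultimately show ?case
            using E f3 p size' low below
            by (intro runs_ISet) (simp_all add: search_inv_def)
        next
          case 2
          then have "b p \<le> prescore I A w c (b p)" using c(2) f3 by simp
          then have "\<exists>c\<in>cands I - A. b p \<le> prescore I A w c (b p)" using c(1) by blast
          moreover have "b q \<le> b p" if "q < Suc p" for q using sorted[of q p] that p by simp
          moreover have "stores (\<sigma>3\<lparr>ivar := (ivar \<sigma>3)(''first'' := Suc p), rvar := (rvar \<sigma>3)(''low'' := b p)\<rparr>)
              I A w vs cs es sel"
            by (rule stores_agree[OF st3, of "{''first'', ''low''}"]) (auto simp: agree_def inputs_def)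
          ultimately show ?case
            using E f3 p size' hi above nonneg[OF p(3)]
            by (intro runs_Seq runs_ISet runs_RSet) (simp_all add: search_inv_def)
        qed
      qed
    qed
  qed
  with u show ?thesis by blast
qed

text \<open>The conclusion supplies what \<open>affine_score_argmax\<close> demands of
  \<open>h\<close>. When \<open>first\<close> and \<open>last\<close> meet, every support is
  decided.\<close>

lemma search_com:
  assumes st: "stores \<sigma> I A w vs cs es sel" and b: "rarr \<sigma> ''sorted'' = b"
    and sorted: "\<And>x y. x \<le> y \<Longrightarrow> y < length sel \<Longrightarrow> b x \<le> b y" and img: "b ` {..<length sel} = supp I w ` A"
    and L: "length sel < 2 ^ L"  "1 \<le> L"
  shows "runs (length es * L) search_com \<sigma> (\<lambda>\<sigma>'. 0 \<le> rvar \<sigma>' ''low'' \<and>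
    (\<exists>c\<in>cands I - A. rvar \<sigma>' ''low'' \<le> prescore I A w c (rvar \<sigma>' ''low'')) \<and>
    (\<forall>c'\<in>A. \<forall>c\<in>cands I - A. rvar \<sigma>' ''low'' < supp I w c' \<longrightarrow>
       prescore I A w c (supp I w c') < supp I w c'))"
proof -
  have E: "1 \<le> length es" using stores_bounds[OF st] by simp
  have EL: "1 \<le> length es * L" using E L(2) mult_le_mono[of 1 "length es" 1 L] by simp
  have nonneg: "0 \<le> b q" if "q < length sel" for q
  proof -
    have "b q \<in> supp I w ` A" using img that by blast
    then show ?thesis using supp_nonneg by auto
  qed
  let ?Inv = "search_inv b vs cs es sel"
  show ?thesis
    unfolding search_com_def
  proof (rule runs_SeqI[where S = "?Inv L"], goal_cases)
    case 1
    obtain c where "c \<in> cands I - A" using unselected_nonempty by blast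
    then have "\<exists>c\<in>cands I - A. 0 \<le> prescore I A w c 0" using prescore_0 by blast
    moreover have "stores (\<sigma>\<lparr>ivar := (ivar \<sigma>)(''first'' := 0, ''last'' := length sel),
        rvar := (rvar \<sigma>)(''low'' := 0)\<rparr>) I A w vs cs es sel"
      by (rule stores_agree[OF st, of "{''first'', ''last'', ''low''}"]) (auto simp: agree_def inputs_def)
    ultimately show ?case
      using EL b L storesD(12)[OF st]
      by (intro runs_Seq runs_ISet runs_RSet) (simp_all add: search_inv_def)
  next
    case (2 \<sigma>1)
    show ?case
    proof (rule runs_conseq[OF runs_While[where Inv = ?Inv and v = L] order_refl], goal_cases)
      case (1 v \<sigma>')
      then show ?case using search_step_com[OF _ _ sorted nonneg] by simp
    next
      case (6 \<sigma>')
      then obtain u where inv: "?Inv u \<sigma>'" and "\<not> ivar \<sigma>' ''first'' < ivar \<sigma>' ''last''" by auto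
      then have eq: "ivar \<sigma>' ''first'' = ivar \<sigma>' ''last''" by (simp add: search_inv_def)
      have "prescore I A w c (supp I w c') < supp I w c'"
        if c: "c' \<in> A" "c \<in> cands I - A" "rvar \<sigma>' ''low'' < supp I w c'" for c c'
      proof -
        obtain q where q: "q < length sel" "supp I w c' = b q" using img c(1) by auto
        then have "\<not> q < ivar \<sigma>' ''first''" using inv c(3) by (auto simp: search_inv_def)
        then show ?thesis using inv q c(2) eq by (auto simp: search_inv_def)
      qed
      then show ?case using inv by (auto simp: search_inv_def)
    qed (use 2 E L in auto)
  qed
qed

lemma solve_com:
  assumes st: "stores \<sigma> I A w vs cs es sel"
  shows "runs (length es) solve_com \<sigma> (\<lambda>\<sigma>'. \<exists>c. argmax_at \<sigma>' cs (affine_score (rvar \<sigma> ''low'')) c)"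
proof -
  let ?h = "rvar \<sigma> ''low''"
  have E: "1 \<le> length es" using stores_bounds[OF st] by simp
  show ?thesis
    unfolding solve_com_def
  proof (rule runs_SeqI[where S = "\<lambda>\<sigma>'. rvar \<sigma>' ''h'' = ?h \<and> rvar \<sigma>' ''t'' = 0"], goal_cases)
    case 1
    show ?case using E by (intro runs_intros) auto
  next
    case (2 \<sigma>1)
    have st1: "stores \<sigma>1 I A w vs cs es sel" using stores_agree[OF st 2(2)] by (simp add: inputs_def)
    note h1 = 2(1)
    show ?case
    proof (rule runs_SeqI[OF prescores_com[OF st1]], goal_cases)
      case (1 \<sigma>2)
      have st2: "stores \<sigma>2 I A w vs cs es sel"
        using stores_agree[OF st1 1(2)] by (simp add: inputs_def writes_prescores_com)
      have h2: "rvar \<sigma>2 ''h'' = ?h" using agreeD[OF 1(2)] h1 by (simp add: writes_prescores_com)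
      note p2 = 1(1)
      show ?case
      proof (rule runs_SeqI[where S = "\<lambda>\<sigma>'. \<forall>c<length cs. rarr \<sigma>' ''value'' c = affine_prescore I A w ?h (cs ! c) 0"],
          goal_cases)
        case 1
        then show ?case
          using storesD[OF st2] stores_bounds[OF st2] p2 h1 by (intro runs_For_RStore) (auto simp: agree_def)
      next
        case (2 \<sigma>3)
        have st3: "stores \<sigma>3 I A w vs cs es sel" using stores_agree[OF st2 2(2)] by (simp add: inputs_def)
        have h3: "rvar \<sigma>3 ''h'' = ?h" using agreeD[OF 2(2)] h2 by simp
        note v3 = 2(1)
        show ?case
        proof (rule runs_SeqI[where S = "\<lambda>\<sigma>'. rvar \<sigma>' ''t'' = 1"], goal_cases)
          case 1
          show ?case using E by (intro runs_intros) auto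
        next
          case (2 \<sigma>4)
          have st4: "stores \<sigma>4 I A w vs cs es sel" using stores_agree[OF st3 2(2)] by (simp add: inputs_def)
          have h4: "rvar \<sigma>4 ''h'' = ?h" "rvar \<sigma>4 ''t'' = 1" "rarr \<sigma>4 ''value'' = rarr \<sigma>3 ''value''"
            using agreeD[OF 2(2)] h3 2(1) by auto
          show ?case
          proof (rule runs_SeqI[OF prescores_com[OF st4]], goal_cases)
            case (1 \<sigma>5)
            have st5: "stores \<sigma>5 I A w vs cs es sel"
              using stores_agree[OF st4 1(2)] by (simp add: inputs_def writes_prescores_com)
            have v5: "\<forall>c<length cs. rarr \<sigma>5 ''value'' c = affine_prescore I A w ?h (cs ! c) 0"
              using agreeD[OF 1(2)] h4 v3 by (simp add: writes_prescores_com)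
            have p5: "\<forall>c<length cs. rarr \<sigma>5 ''prescore'' c = affine_prescore I A w ?h (cs ! c) 1"
              using 1(1) h4 by simp
            show ?case
            proof (rule runs_SeqI[where S = "\<lambda>\<sigma>'. \<forall>c<length cs. rarr \<sigma>' ''value'' c = affine_score ?h (cs ! c)"],
                goal_cases)
              case 1
              then show ?case
                using storesD[OF st5] stores_bounds[OF st5] p5 v5
                by (intro runs_For_RStore) (auto simp: agree_def affine_score_def)
            next
              case (2 \<sigma>6)
              have "stores \<sigma>6 I A w vs cs es sel" using stores_agree[OF st5 2(2)] by (simp add: inputs_def)
              then show ?case using 2(1) by (rule select_com)
            qed
          qed
        qed
      qed
    qed
  qed
qed

lemma score_com:
  assumes st: "stores \<sigma> I A w vs cs es sel" and L: "length sel < 2 ^ L" "1 \<le> L"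
  shows "runs (length es * L) score_com \<sigma> (\<lambda>\<sigma>'. \<exists>c. c \<in> cands I - A \<and>
    returns \<sigma>' cs c (score I A w c) \<and> score I A w c = Max (score I A w ` (cands I - A)))"
  unfolding score_com_def
proof (rule runs_SeqI[OF sort_com[where m = "length sel" and E = "length es" and L = L]], goal_cases)
  case (6 \<sigma>1)
  have st1: "stores \<sigma>1 I A w vs cs es sel"
    using stores_agree[OF st 6(2)] by (simp add: inputs_def writes_sort_com)
  let ?m = "length sel"
  have sorted: "rarr \<sigma>1 ''sorted'' x \<le> rarr \<sigma>1 ''sorted'' y" if "x \<le> y" "y < ?m" for x y
    using 6(1) that unfolding sorted_runs_def by simp
  have "rarr \<sigma> ''supp'' ` {..<?m} = (\<lambda>q. supp I w (sel ! q)) ` {..<?m}"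
    using storesD(21)[OF st] by (intro image_cong) auto
  also have "\<dots> = supp I w ` ((!) sel ` {..<?m})" by (simp add: image_image)
  also have "(!) sel ` {..<?m} = A" using storesD(8)[OF st] by (auto simp: set_conv_nth)
  finally have img: "rarr \<sigma>1 ''sorted'' ` {..<?m} = supp I w ` A" using 6(1) by simp
  show ?case
  proof (rule runs_SeqI[OF search_com[OF st1 refl sorted img L]], goal_cases)
    case (3 \<sigma>2)
    have st2: "stores \<sigma>2 I A w vs cs es sel"
      using stores_agree[OF st1 3(2)] by (simp add: inputs_def writes_search_com writes_threshold_com)
    have EL: "length es \<le> length es * L" using L(2) mult_le_mono2[of 1 L "length es"] by simp
    show ?case
    proof (rule runs_conseq[OF solve_com[OF st2] EL])
      fix \<sigma>' assume "\<exists>c. argmax_at \<sigma>' cs (affine_score (rvar \<sigma>2 ''low'')) c"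
      then obtain c where c: "argmax_at \<sigma>' cs (affine_score (rvar \<sigma>2 ''low'')) c" by blast
      obtain c0 where c0: "0 \<le> rvar \<sigma>2 ''low''" "c0 \<in> cands I - A"
        "rvar \<sigma>2 ''low'' \<le> prescore I A w c0 (rvar \<sigma>2 ''low'')" using 3(1) by blast
      have "affine_score (rvar \<sigma>2 ''low'') c = score I A w c"
        "score I A w c = Max (score I A w ` (cands I - A))"
        by (rule affine_score_argmax[OF c0]; use 3(1) c in \<open>auto simp: argmax_at_def\<close>)+
      then show "\<exists>c. c \<in> cands I - A \<and> returns \<sigma>' cs c (score I A w c) \<and>
          score I A w c = Max (score I A w ` (cands I - A))"
        using c by (intro exI[of _ c]) (simp add: argmax_at_def)
    qed
  qed
qed (use storesD[OF st] stores_bounds[OF st] L in auto)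

end

section \<open>The two algorithms with explicit constants\<close>

theorem theorem6:
  "(\<exists>(P :: com) (K :: real).
      \<forall>(I :: ('n, 'c) election) A w t \<sigma> vs cs es sel.
        election_instance I \<longrightarrow> partial_solution I A w \<longrightarrow> 0 \<le> t \<longrightarrow>
        stores \<sigma> I A w vs cs es sel \<longrightarrow> rvar \<sigma> ''t'' = t \<longrightarrow>
        halts_within P \<sigma> (K * real (card (edges I)))
          (\<lambda>\<sigma>'. \<exists>c p. returns \<sigma>' cs c p \<and> c \<in> cands I - A \<and>
             p = prescore I A w c t \<and>
             p = Max ((\<lambda>c'. prescore I A w c' t) ` (cands I - A))))
   \<and>
   (\<exists>(P :: com) (K :: real).
      \<forall>(I :: ('n, 'c) election) A w \<sigma> vs cs es sel.
        election_instance I \<longrightarrow> partial_solution I A w \<longrightarrow>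
        stores \<sigma> I A w vs cs es sel \<longrightarrow>
        halts_within P \<sigma> (K * (real (card (edges I)) * max 1 (log 2 (real (seats I)))))
          (\<lambda>\<sigma>'. \<exists>c r. returns \<sigma>' cs c r \<and> c \<in> cands I - A \<and>
             r = score I A w c \<and>
             r = Max ((\<lambda>c'. score I A w c') ` (cands I - A))))"
proof (intro conjI exI allI impI)
  fix I :: "('n, 'c) election" and A w t \<sigma> vs cs es sel
  assume "election_instance I" "partial_solution I A w" and t: "0 \<le> t" "rvar \<sigma> ''t'' = t"
    and st: "stores \<sigma> I A w vs cs es sel"
  then interpret solution I A w by unfold_locales
  have E: "card (edges I) = length es" using storesD(5,6)[OF st] distinct_card by metis
  show "halts_within threshold_com \<sigma> (real (unit_cost threshold_com) * real (card (edges I)))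
    (\<lambda>\<sigma>'. \<exists>c p. returns \<sigma>' cs c p \<and> c \<in> cands I - A \<and> p = prescore I A w c t \<and>
       p = Max ((\<lambda>c'. prescore I A w c' t) ` (cands I - A)))"
  proof (rule halts_within_runs[OF threshold_com[OF st t(2,1)]])
    fix \<sigma>' assume "\<exists>c. argmax_at \<sigma>' cs (\<lambda>c. prescore I A w c t) c"
    then obtain c where c: "argmax_at \<sigma>' cs (\<lambda>c. prescore I A w c t) c" by blast
    then have "prescore I A w c t = Max ((\<lambda>c'. prescore I A w c' t) ` (cands I - A))"
      using finite_cands by (intro Max_eqI[symmetric]) (auto simp: argmax_at_def)
    then show "\<exists>c p. returns \<sigma>' cs c p \<and> c \<in> cands I - A \<and> p = prescore I A w c t \<and>
        p = Max ((\<lambda>c'. prescore I A w c' t) ` (cands I - A))"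
      using c unfolding argmax_at_def by blast
  qed (simp add: E)
next
  fix I :: "('n, 'c) election" and A w \<sigma> vs cs es sel
  assume inst: "election_instance I" "partial_solution I A w"
    and st: "stores \<sigma> I A w vs cs es sel"
  then interpret solution I A w by unfold_locales
  have E: "card (edges I) = length es" using storesD(5,6)[OF st] distinct_card by metis
  define l where "l = log 2 (real (seats I))"
  \<comment> \<open>The ceiling alone gives \<open>seats I \<le> 2 ^ L\<close>; one more makes this
    strict, as the search requires, and keeps \<open>L\<close> positive for a single seat, where the
    logarithm is 0.\<close>
  define L where "L = nat \<lceil>l\<rceil> + 1"
  have k: "0 < seats I" using inst by (simp add: election_instance_def)
  have "length sel = card A" using storesD(7,8)[OF st] distinct_card by metis
  then have "length sel \<le> seats I" using inst by (simp add: partial_solution_def)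
  moreover have "real (seats I) < 2 ^ L"
  proof -
    have "real (seats I) = 2 powr l" using k by (simp add: l_def)
    also have "\<dots> < 2 powr real L" unfolding L_def by (intro powr_less_mono) linarith+
    finally show ?thesis by (simp add: powr_realpow)
  qed
  then have "seats I < 2 ^ L" by (metis of_nat_less_iff of_nat_numeral of_nat_power)
  ultimately have L: "length sel < 2 ^ L" "1 \<le> L" by (simp_all add: L_def)
  have "0 \<le> l" using k by (simp add: l_def)
  \<comment> \<open>\<open>L\<close> is at most \<open>l + 2\<close>, and both summands are bounded
    by multiples of \<open>max 1 l\<close>, whence the constant 3.\<close>
  then have "real L \<le> 3 * max 1 l" unfolding L_def by linarith
  then have "real (unit_cost score_com * length es) * real L
      \<le> real (unit_cost score_com * length es) * (3 * max 1 l)" by (rule mult_left_mono) simp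
  then have B: "real (unit_cost score_com * (length es * L))
      \<le> 3 * real (unit_cost score_com) * (real (card (edges I)) * max 1 (log 2 (real (seats I))))"
    by (simp add: E l_def algebra_simps)
  show "halts_within score_com \<sigma>
    (3 * real (unit_cost score_com) * (real (card (edges I)) * max 1 (log 2 (real (seats I)))))
    (\<lambda>\<sigma>'. \<exists>c r. returns \<sigma>' cs c r \<and> c \<in> cands I - A \<and> r = score I A w c \<and>
       r = Max ((\<lambda>c'. score I A w c') ` (cands I - A)))"
    by (rule halts_within_runs[OF score_com[OF st L] B]) blast
qed

end
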